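(* Let $\Omega\subset\mathbb C^m$ be a domain. Suppose that $K_1$ and $K_2$ are two scalar valued (sesqui-analytic) positive definite kernels on $\Omega$ satisfying $K_1\succeq K_2$. Then $$\mathcal G_{K_1^{-1}}(z,w)\succeq\mathcal G_{K_2^{-1}}(z,w).$$
   Context: A function $K:\Omega\times\Omega\to\mathcal M_n(\mathbb C)$ is sesqui-analytic if $K(z,w)$ is holomorphic in $z$ and anti-holomorphic in $w$. It is a non-negative definite (resp. positive definite) kernel if for every finite set $\{x_1,\dots,x_p\}\subset\Omega$ of distinct points the $np\times np$ block matrix $(K(x_i,x_j))_{i,j=1}^p$ is non-negative definite (resp. positive definite). $K\succeq0$ means that $K$ is non-negative definite, and $K_1\succeq K_2$ means $K_1-K_2\succeq0$. For a scalar sesqui-analytic non-negative definite kernel $K$ on $\Omega\subset\mathbb C^m$, the Gaussian curvature is the $\mathcal M_m(\mathbb C)$-valued function $$\mathcal G_{K^{-1}}(z,w)=\Big(K(z,w)\,\partial_i\bar\partial_jK(z,w)-\partial_iK(z,w)\,\bar\partial_jK(z,w)\Big)_{i,j=1}^m,$$ where $\partial_i=\frac{\partial}{\partial z_i}$ and $\bar\partial_j=\frac{\partial}{\partial\bar w_j}$. *)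

theory Defs
  imports "HOL-Analysis.Analysis"
begin

text \<open>
  Holomorphy of functions of several complex variables: the real Frechet derivative
  exists and is complex-linear. The library notion \<open>holomorphic_on\<close> covers one variable only.
\<close>

definition holomorphic_mv_on ::
  "(complex ^ 'm \<Rightarrow> complex) \<Rightarrow> (complex ^ 'm) set \<Rightarrow> bool" where
  "holomorphic_mv_on f S \<longleftrightarrow>
     (\<forall>z\<in>S. \<exists>D. (f has_derivative D) (at z within S) \<and> (\<forall>c v. D (c *s v) = c * D v))"

definition antiholomorphic_mv_on ::
  "(complex ^ 'm \<Rightarrow> complex) \<Rightarrow> (complex ^ 'm) set \<Rightarrow> bool" where
  "antiholomorphic_mv_on f S \<longleftrightarrow> holomorphic_mv_on (\<lambda>z. cnj (f z)) S"

text \<open>Only separate holomorphy in each of the two arguments is required.\<close>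

definition sesqui_analytic_on ::
  "(complex ^ 'm) set \<Rightarrow> (complex ^ 'm \<Rightarrow> complex ^ 'm \<Rightarrow> complex ^ 'n ^ 'n) \<Rightarrow> bool" where
  "sesqui_analytic_on \<Omega> K \<longleftrightarrow>
     (\<forall>a b. (\<forall>w\<in>\<Omega>. holomorphic_mv_on (\<lambda>z. K z w $ a $ b) \<Omega>) \<and>
            (\<forall>z\<in>\<Omega>. antiholomorphic_mv_on (\<lambda>w. K z w $ a $ b) \<Omega>))"

text \<open>
  Definiteness of a complex matrix whose rows and columns are indexed by a finite set \<open>I\<close>.
  Over the complex numbers, real-valuedness of the form already makes the matrix Hermitian.
\<close>

definition quad_form :: "'i set \<Rightarrow> ('i \<Rightarrow> 'i \<Rightarrow> complex) \<Rightarrow> ('i \<Rightarrow> complex) \<Rightarrow> complex" where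
  "quad_form I A v = (\<Sum>k\<in>I. \<Sum>l\<in>I. cnj (v k) * A k l * v l)"

definition nonneg_definite_matrix :: "'i set \<Rightarrow> ('i \<Rightarrow> 'i \<Rightarrow> complex) \<Rightarrow> bool" where
  "nonneg_definite_matrix I A \<longleftrightarrow>
     (\<forall>v. quad_form I A v \<in> \<real> \<and> 0 \<le> Re (quad_form I A v))"

definition pos_definite_matrix :: "'i set \<Rightarrow> ('i \<Rightarrow> 'i \<Rightarrow> complex) \<Rightarrow> bool" where
  "pos_definite_matrix I A \<longleftrightarrow>
     (\<forall>v. (\<exists>k\<in>I. v k \<noteq> 0) \<longrightarrow> quad_form I A v \<in> \<real> \<and> 0 < Re (quad_form I A v))"

text \<open>
  For a finite set \<open>X\<close> of (automatically distinct) points, the block matrix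
  \<open>(K(x, y))\<close> with \<open>x, y \<in> X\<close> has rows and columns indexed by \<open>X \<times> UNIV\<close>.
\<close>

definition block_matrix ::
  "('z \<Rightarrow> 'z \<Rightarrow> complex ^ 'n ^ 'n) \<Rightarrow> 'z \<times> 'n \<Rightarrow> 'z \<times> 'n \<Rightarrow> complex" where
  "block_matrix K p q = K (fst p) (fst q) $ snd p $ snd q"

definition nonneg_definite_kernel ::
  "'z set \<Rightarrow> ('z \<Rightarrow> 'z \<Rightarrow> complex ^ 'n ^ 'n) \<Rightarrow> bool" where
  "nonneg_definite_kernel \<Omega> K \<longleftrightarrow>
     (\<forall>X. finite X \<and> X \<subseteq> \<Omega> \<longrightarrow> nonneg_definite_matrix (X \<times> UNIV) (block_matrix K))"

definition pos_definite_kernel ::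
  "'z set \<Rightarrow> ('z \<Rightarrow> 'z \<Rightarrow> complex ^ 'n ^ 'n) \<Rightarrow> bool" where
  "pos_definite_kernel \<Omega> K \<longleftrightarrow>
     (\<forall>X. finite X \<and> X \<subseteq> \<Omega> \<longrightarrow> pos_definite_matrix (X \<times> UNIV) (block_matrix K))"

text \<open>\<open>kernel_ge \<Omega> K L\<close> is the order relation usually written \<open>K \<succeq> L\<close>.\<close>

definition kernel_ge ::
  "'z set \<Rightarrow> ('z \<Rightarrow> 'z \<Rightarrow> complex ^ 'n ^ 'n) \<Rightarrow> ('z \<Rightarrow> 'z \<Rightarrow> complex ^ 'n ^ 'n) \<Rightarrow> bool" where
  "kernel_ge \<Omega> K L \<longleftrightarrow> nonneg_definite_kernel \<Omega> (\<lambda>z w. K z w - L z w)"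

definition scalar_kernel :: "('z \<Rightarrow> 'z \<Rightarrow> complex) \<Rightarrow> 'z \<Rightarrow> 'z \<Rightarrow> complex ^ 1 ^ 1" where
  "scalar_kernel K z w = mat (K z w)"

text \<open>
  Wirtinger derivatives with respect to \<open>z\<^sub>i\<close> and its conjugate: with \<open>z\<^sub>i = x + iy\<close> these are
  \<open>(\<partial>/\<partial>x - i \<partial>/\<partial>y) / 2\<close> and \<open>(\<partial>/\<partial>x + i \<partial>/\<partial>y) / 2\<close>.
\<close>

definition wirtinger :: "'m \<Rightarrow> (complex ^ 'm \<Rightarrow> complex) \<Rightarrow> complex ^ 'm \<Rightarrow> complex" where
  "wirtinger i f z =
     (vector_derivative (\<lambda>t::real. f (z + axis i (of_real t))) (at 0)
      - \<i> * vector_derivative (\<lambda>t::real. f (z + axis i (\<i> * of_real t))) (at 0)) / 2"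

definition wirtinger_bar :: "'m \<Rightarrow> (complex ^ 'm \<Rightarrow> complex) \<Rightarrow> complex ^ 'm \<Rightarrow> complex" where
  "wirtinger_bar j f z =
     (vector_derivative (\<lambda>t::real. f (z + axis j (of_real t))) (at 0)
      + \<i> * vector_derivative (\<lambda>t::real. f (z + axis j (\<i> * of_real t))) (at 0)) / 2"

text \<open>
  \<open>gaussian_curvature K\<close> is the matrix-valued function \<open>\<G>\<close> with subscript \<open>K\<^sup>-\<^sup>1\<close>; holomorphic
  derivatives act on the first argument of \<open>K\<close>, conjugate ones on the second.
\<close>

definition gaussian_curvature ::
  "(complex ^ 'm \<Rightarrow> complex ^ 'm \<Rightarrow> complex) \<Rightarrow> complex ^ 'm \<Rightarrow> complex ^ 'm \<Rightarrow> complex ^ 'm ^ 'm" where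
  "gaussian_curvature K z w =
     (\<chi> i j. K z w * wirtinger i (\<lambda>z'. wirtinger_bar j (\<lambda>w'. K z' w') w) z
            - wirtinger i (\<lambda>z'. K z' w) z * wirtinger_bar j (\<lambda>w'. K z w') w)"

end

theory Submission
  imports Defs "HOL-Complex_Analysis.Complex_Analysis" "HOL-Real_Asymp.Real_Asymp"
begin

text \<open>
  The curvature \<open>K \<partial>\<^sub>i\<partial>\<^sub>j\<^sup>*K - \<partial>\<^sub>iK \<partial>\<^sub>j\<^sup>*K\<close> (with \<open>\<partial>\<^sub>j\<^sup>*\<close> the derivative in the conjugate of \<open>w\<^sub>j\<close>) is
  quadratic in \<open>K\<close>, so a difference of two curvatures is a polarised form. With \<open>A = K1 + K2\<close> and
  \<open>B = K1 - K2\<close>, both non-negative definite, twice the difference is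
  \<open>A \<partial>\<^sub>i\<partial>\<^sub>j\<^sup>*B + B \<partial>\<^sub>i\<partial>\<^sub>j\<^sup>*A - \<partial>\<^sub>iA \<partial>\<^sub>j\<^sup>*B - \<partial>\<^sub>iB \<partial>\<^sub>j\<^sup>*A\<close>.
  Were \<open>A(z,w) = \<langle>e(z), e(w)\<rangle>\<close> and \<open>B(z,w) = \<langle>f(z), f(w)\<rangle>\<close> for holomorphic Hilbert-space valued \<open>e\<close> and
  \<open>f\<close>, this would be the Gram kernel of the vectors \<open>e \<otimes> \<partial>\<^sub>if - \<partial>\<^sub>ie \<otimes> f\<close>, hence non-negative definite.

  Difference quotients make this rigorous without Hilbert spaces. Replace the vector
  attached to a point \<open>x\<close> and a direction \<open>i\<close> by \<open>e(x) \<otimes> f(x + h\<epsilon>\<^sub>i) - e(x + h\<epsilon>\<^sub>i) \<otimes> f(x)\<close>, where \<open>\<epsilon>\<^sub>i\<close>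
  is the unit vector. Its Gram matrix is a combination of products of values of \<open>A\<close> and \<open>B\<close> and is
  non-negative definite by the Schur product theorem
  (\<open>nonneg_definite_antisymmetrized_product\<close>); after division by \<open>2h\<^sup>2\<close> it converges entrywise to the
  difference of the curvatures (\<open>gaussian_curvature_difference_limit\<close>).

  This limit moves both arguments of the kernels simultaneously, while holomorphy is given only in
  each argument separately. What bridges the gap is Hartogs' theorem for a function
  \<open>\<phi>(s,t)\<close> of two complex variables (\<open>hartogs_locally_bounded\<close>); two variables suffice because
  the points are shifted along coordinate axes only. From local boundedness, Cauchy's estimates give
  the convergence of the mixed second difference quotient and the differentiability in \<open>s\<close> of the
  derivative in \<open>t\<close>, on which the iterated Wirtinger derivatives depend
  (\<open>mixed_difference_quotient_tendsto\<close>).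

  Hartogs' theorem itself is proved as follows. By Baire, \<open>\<phi>\<close> is bounded on a
  slab \<open>\<bar>s\<bar> \<le> \<rho>, \<bar>t - b\<bar> < \<epsilon>\<close> with \<open>b\<close> close to \<open>0\<close>. The Taylor coefficients \<open>c\<^sub>n(s)\<close> of
  \<open>\<phi>(s, \<cdot>)\<close> at \<open>b\<close> are then holomorphic with the uniform but poor bound \<open>C/\<epsilon>\<^sup>n\<close>, whereas for each single
  \<open>s\<close> the convergence of the series on a large disc gives a good bound with a constant depending on
  \<open>s\<close>. Hartogs' lemma (\<open>hartogs_lemma\<close>) turns the latter into a uniform bound: the set of \<open>s\<close> on a
  circle where the constant is large has small measure, and the two-constants theorem
  (\<open>two_constants_arcs\<close>) says that a small set of boundary points has little influence inside.
\<close>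

section \<open>Cauchy estimates\<close>

lemma deriv_bound_half_ball:
  assumes "f holomorphic_on ball a r" and "\<And>z. z \<in> ball a r \<Longrightarrow> cmod (f z) \<le> M"
    and "z \<in> ball a (r/2)"
  shows "cmod (deriv f z) \<le> 4 * M / r"
proof -
  have r: "r > 0"
    using assms(3) by (metis centre_in_ball dist_not_less_zero half_gt_zero_iff linorder_not_le mem_ball order_le_less_trans zero_le_dist)
  have sub: "cball z (r/4) \<subseteq> ball a r"
  proof
    fix y assume "y \<in> cball z (r/4)"
    then show "y \<in> ball a r"
      using assms(3) dist_triangle[of a y z] r by (auto simp: mem_ball mem_cball)
  qed
  have "cmod ((deriv ^^ 1) f z) \<le> fact 1 * M / (r/4) ^ 1"
  proof (rule Cauchy_inequality)
    show "f holomorphic_on ball z (r/4)"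
      using assms(1) sub ball_subset_cball holomorphic_on_subset by blast
    show "continuous_on (cball z (r/4)) f"
      using assms(1) sub holomorphic_on_imp_continuous_on continuous_on_subset by blast
    show "cmod (f x) \<le> M" if "cmod (z - x) = r/4" for x
      using that sub by (intro assms(2)) (auto simp: dist_norm)
  qed (use r in auto)
  then show ?thesis by (simp add: mult.commute)
qed

lemma bounded_holomorphic_lipschitz:
  assumes "f holomorphic_on ball a r" and "\<And>z. z \<in> ball a r \<Longrightarrow> cmod (f z) \<le> M"
    and "x \<in> ball a (r/2)" and "y \<in> ball a (r/2)"
  shows "cmod (f x - f y) \<le> 4 * M / r * cmod (x - y)"
proof (rule field_differentiable_bound[where S = "ball a (r/2)" and f' = "deriv f"])
  have sub: "ball a (r/2) \<subseteq> ball a r"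
    using assms(3) by (metis ball_eq_empty empty_iff field_sum_of_halves half_gt_zero_iff
        less_add_same_cancel2 linorder_not_le order_less_imp_le subset_ball)
  fix z assume z: "z \<in> ball a (r/2)"
  then show "(f has_field_derivative deriv f z) (at z within ball a (r/2))"
    using assms(1) sub holomorphic_derivI[of f "ball a r" z] by (meson has_field_derivative_at_within open_ball subsetD)
  show "cmod (deriv f z) \<le> 4 * M / r"
    using deriv_bound_half_ball assms(1,2) z by blast
qed (use assms in auto)

text \<open>
  The mean value inequality for \<open>x \<mapsto> f x - x f'(a)\<close>, whose derivative \<open>f' - f'(a)\<close> is small near \<open>a\<close>
  because \<open>f'\<close> is itself bounded and hence Lipschitz on a smaller ball. What matters later is that the
  constant depends on the bound \<open>M\<close> and the radius only, so that it is uniform over families.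
\<close>

lemma bounded_holomorphic_first_order_remainder:
  assumes hol: "f holomorphic_on ball a r" and bd: "\<And>z. z \<in> ball a r \<Longrightarrow> cmod (f z) \<le> M"
    and h: "cmod h < r/4"
  shows "cmod (f (a + h) - f a - h * deriv f a) \<le> 32 * M / r^2 * (cmod h)^2"
proof -
  have r: "r > 0" using h norm_ge_zero[of h] by linarith
  have sub: "ball a (r/2) \<subseteq> ball a r" "ball a (r/4) \<subseteq> ball a (r/2)"
    using r by (auto intro!: subset_ball)
  have hol': "deriv f holomorphic_on ball a (r/2)"
    using hol sub(1) by (meson holomorphic_deriv holomorphic_on_subset open_ball)
  have bd': "cmod (deriv f z) \<le> 4 * M / r" if "z \<in> ball a (r/2)" for z
    using deriv_bound_half_ball[OF hol bd that] by simp
  have M: "M \<ge> 0"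
    using bd[of a] r norm_ge_zero[of "f a"] by (meson centre_in_ball order_trans)
  define F where "F x = f x - x * deriv f a" for x
  let ?S = "cball a (cmod h)"
  have S: "?S \<subseteq> ball a (r/4)" using h by auto
  have "cmod (F (a + h) - F a) \<le> (32 * M / r^2 * cmod h) * cmod ((a + h) - a)"
  proof (rule field_differentiable_bound[where S = ?S and f' = "\<lambda>x. deriv f x - deriv f a"])
    fix z assume z: "z \<in> ?S"
    then have z4: "z \<in> ball a (r/4)" using S by blast
    have "(f has_field_derivative deriv f z) (at z within ?S)"
      using z4 sub hol by (meson has_field_derivative_at_within holomorphic_derivI open_ball subsetD)
    then show "(F has_field_derivative deriv f z - deriv f a) (at z within ?S)"
      unfolding F_def by (auto intro!: derivative_eq_intros)
    have "cmod (deriv f z - deriv f a) \<le> 4 * (4 * M / r) / (r/2) * cmod (z - a)"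
      by (rule bounded_holomorphic_lipschitz[OF hol' bd']) (use z4 r in auto)
    also have "\<dots> \<le> 4 * (4 * M / r) / (r/2) * cmod h"
      using z M r by (intro mult_left_mono) (auto simp: dist_norm norm_minus_commute)
    also have "\<dots> = 32 * M / r^2 * cmod h"
      using r by (simp add: field_simps power2_eq_square)
    finally show "cmod (deriv f z - deriv f a) \<le> 32 * M / r^2 * cmod h" .
  qed (auto simp: dist_norm)
  moreover have "F (a + h) - F a = f (a + h) - f a - h * deriv f a"
    by (simp add: F_def algebra_simps)
  ultimately show ?thesis by (simp add: power2_eq_square mult.assoc)
qed

section \<open>Partial derivatives of separately holomorphic functions\<close>

definition separately_holomorphic ::
  "complex set \<Rightarrow> complex set \<Rightarrow> (complex \<Rightarrow> complex \<Rightarrow> complex) \<Rightarrow> bool" where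
  "separately_holomorphic S T \<phi> \<longleftrightarrow>
     (\<forall>t\<in>T. (\<lambda>s. \<phi> s t) holomorphic_on S) \<and> (\<forall>s\<in>S. \<phi> s holomorphic_on T)"

lemma separately_holomorphic_subset:
  "separately_holomorphic S T \<phi> \<Longrightarrow> S' \<subseteq> S \<Longrightarrow> T' \<subseteq> T \<Longrightarrow> separately_holomorphic S' T' \<phi>"
  unfolding separately_holomorphic_def by (meson holomorphic_on_subset subsetD)

text \<open>
  A bound on \<open>\<phi>\<close> that is uniform in \<open>s\<close> makes the difference quotients in \<open>t\<close>, which are holomorphic
  in \<open>s\<close>, converge uniformly in \<open>s\<close>.
\<close>

lemma holomorphic_partial_deriv:
  assumes "open S" and sep: "separately_holomorphic S (ball b r) \<phi>"
    and bd: "\<And>s t. s \<in> S \<Longrightarrow> t \<in> ball b r \<Longrightarrow> cmod (\<phi> s t) \<le> C" and "r > 0"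
  shows "(\<lambda>s. deriv (\<phi> s) b) holomorphic_on S"
proof (rule holomorphic_uniform_sequence[OF \<open>open S\<close>])
  define h where "h n = r / (5 + real n)" for n
  have hpos: "0 < h n" "h n < r/4" for n
  proof -
    have "r / (5 + real n) \<le> r / 5" using \<open>r > 0\<close> by (intro divide_left_mono) auto
    then show "0 < h n" "h n < r/4" using \<open>r > 0\<close> by (auto simp: h_def)
  qed
  have hlim: "h \<longlonglongrightarrow> 0"
    unfolding h_def by real_asymp
  define f where "f n s = (\<phi> s (b + of_real (h n)) - \<phi> s b) / of_real (h n)" for n s
  show "f n holomorphic_on S" for n
  proof -
    have "b + of_real (h n) \<in> ball b r" "b \<in> ball b r"
      using hpos[of n] \<open>r > 0\<close> by (auto simp: dist_norm)
    then show ?thesis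
      using sep hpos[of n] unfolding f_def separately_holomorphic_def
      by (intro holomorphic_intros) auto
  qed
  have err: "cmod (f n s - deriv (\<phi> s) b) \<le> 32 * C / r^2 * h n" if "s \<in> S" for n s
  proof -
    let ?h = "of_real (h n) :: complex"
    have *: "cmod (\<phi> s (b + ?h) - \<phi> s b - ?h * deriv (\<phi> s) b) \<le> 32 * C / r^2 * (cmod ?h)^2"
      by (rule bounded_holomorphic_first_order_remainder)
         (use sep bd that hpos[of n] in \<open>auto simp: separately_holomorphic_def\<close>)
    have "f n s - deriv (\<phi> s) b = (\<phi> s (b + ?h) - \<phi> s b - ?h * deriv (\<phi> s) b) / ?h"
      using hpos[of n] by (simp add: f_def field_simps)
    then have "cmod (f n s - deriv (\<phi> s) b)
        = cmod (\<phi> s (b + ?h) - \<phi> s b - ?h * deriv (\<phi> s) b) / h n"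
      using hpos[of n] by (simp only: norm_divide norm_of_real abs_of_pos)
    also have "\<dots> \<le> 32 * C / r^2 * (cmod ?h)^2 / h n"
      using * hpos[of n] by (intro divide_right_mono) auto
    finally have "cmod (f n s - deriv (\<phi> s) b) \<le> 32 * C / r^2 * (h n)^2 / h n"
      using hpos[of n] by (simp only: norm_of_real abs_of_pos)
    then show ?thesis using hpos[of n] by (simp add: power2_eq_square)
  qed
  fix x assume "x \<in> S"
  then obtain d where d: "d > 0" "cball x d \<subseteq> S"
    using \<open>open S\<close> open_contains_cball by blast
  have "uniform_limit (cball x d) f (\<lambda>s. deriv (\<phi> s) b) sequentially"
  proof (rule uniform_limitI)
    fix e :: real assume "e > 0"
    have "(\<lambda>n. 32 * C / r^2 * h n) \<longlonglongrightarrow> 32 * C / r^2 * 0"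
      by (intro tendsto_intros hlim)
    then have "\<forall>\<^sub>F n in sequentially. 32 * C / r^2 * h n < e"
      using \<open>e > 0\<close> by (simp add: order_tendstoD(2))
    then show "\<forall>\<^sub>F n in sequentially. \<forall>s\<in>cball x d. dist (f n s) (deriv (\<phi> s) b) < e"
    proof eventually_elim
      case (elim n)
      show ?case
      proof
        fix s assume "s \<in> cball x d"
        then show "dist (f n s) (deriv (\<phi> s) b) < e"
          using err[of s n] d elim by (auto simp: dist_norm)
      qed
    qed
  qed
  then show "\<exists>d>0. cball x d \<subseteq> S \<and> uniform_limit (cball x d) f (\<lambda>s. deriv (\<phi> s) b) sequentially"
    using d by blast
qed

text \<open>
  By induction on \<open>n\<close>, since the hypotheses on \<open>\<phi>\<close> pass to \<open>\<partial>\<phi>/\<partial>t\<close>. A bound on the whole of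
  \<open>S \<times> T\<close> would not do so, as the Cauchy estimate shrinks the domain; the bound is therefore
  only required near each point of \<open>T\<close>, but uniformly over \<open>S\<close>.
\<close>

lemma holomorphic_higher_partial_deriv:
  assumes S: "open S" and T: "open T" and sep: "separately_holomorphic S T \<phi>"
    and bd: "\<And>t. t \<in> T \<Longrightarrow> \<exists>r>0. \<exists>C. \<forall>s\<in>S. \<forall>t'\<in>ball t r \<inter> T. cmod (\<phi> s t') \<le> C"
    and t: "t \<in> T"
  shows "(\<lambda>s. (deriv ^^ n) (\<phi> s) t) holomorphic_on S"
proof -
  have "separately_holomorphic S T (\<lambda>s. (deriv ^^ n) (\<phi> s)) \<and>
     (\<forall>t\<in>T. \<exists>r>0. \<exists>C. \<forall>s\<in>S. \<forall>t'\<in>ball t r \<inter> T. cmod ((deriv ^^ n) (\<phi> s) t') \<le> C)"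
  proof (induction n)
    case 0
    then show ?case using sep bd by auto
  next
    case (Suc n)
    define \<psi> where "\<psi> s = (deriv ^^ n) (\<phi> s)" for s
    have sep\<psi>: "separately_holomorphic S T \<psi>"
      and bd\<psi>: "\<And>t. t \<in> T \<Longrightarrow> \<exists>r>0. \<exists>C. \<forall>s\<in>S. \<forall>t'\<in>ball t r \<inter> T. cmod (\<psi> s t') \<le> C"
      using Suc.IH by (auto simp: \<psi>_def[abs_def])
    have nbhd: "\<exists>r>0. \<exists>C. ball t r \<subseteq> T \<and> (\<forall>s\<in>S. \<forall>t'\<in>ball t r. cmod (\<psi> s t') \<le> C)" if t: "t \<in> T" for t
    proof -
      obtain r C where r: "r > 0" "\<And>s t'. s \<in> S \<Longrightarrow> t' \<in> ball t r \<inter> T \<Longrightarrow> cmod (\<psi> s t') \<le> C"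
        using bd\<psi>[OF t] by blast
      obtain e where "e > 0" "ball t e \<subseteq> T"
        using T t open_contains_ball by blast
      then show ?thesis
        using r by (intro exI[of _ "min r e"] conjI exI[of _ C]) auto
    qed
    have "(\<lambda>s. deriv (\<psi> s) t) holomorphic_on S" if t: "t \<in> T" for t
    proof -
      obtain r C where r: "r > 0" "ball t r \<subseteq> T" "\<forall>s\<in>S. \<forall>t'\<in>ball t r. cmod (\<psi> s t') \<le> C"
        using nbhd[OF t] by blast
      show ?thesis
        by (rule holomorphic_partial_deriv[OF S separately_holomorphic_subset[OF sep\<psi> order_refl r(2)] _ r(1)])
           (use r(3) in blast)
    qed
    moreover have "deriv (\<psi> s) holomorphic_on T" if "s \<in> S" for s
      using sep\<psi> that T by (auto simp: separately_holomorphic_def intro!: holomorphic_deriv)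
    moreover have "\<exists>r>0. \<exists>C. \<forall>s\<in>S. \<forall>t'\<in>ball t r \<inter> T. cmod (deriv (\<psi> s) t') \<le> C" if t: "t \<in> T" for t
    proof -
      obtain r C where r: "r > 0" "ball t r \<subseteq> T" "\<forall>s\<in>S. \<forall>t'\<in>ball t r. cmod (\<psi> s t') \<le> C"
        using nbhd[OF t] by blast
      have "cmod (deriv (\<psi> s) t') \<le> 4 * C / r" if "s \<in> S" "t' \<in> ball t (r/2)" for s t'
        using sep\<psi> that r
        by (intro deriv_bound_half_ball) (auto simp: separately_holomorphic_def intro: holomorphic_on_subset)
      then show ?thesis
        using r(1) by (intro exI[of _ "r/2"] conjI exI[of _ "4*C/r"]) auto
    qed
    ultimately show ?case
      by (simp add: \<psi>_def[abs_def] separately_holomorphic_def)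
  qed
  then show ?thesis using t by (auto simp: separately_holomorphic_def)
qed

section \<open>A two-constants theorem and Hartogs' lemma\<close>

text \<open>
  A bound \<open>M\<close> on the unit circle that improves to \<open>N\<close> outside finitely many arcs gives a bound close
  to \<open>N\<close> inside, if the arcs are short in total. The usual proof compares \<open>ln \<bar>f\<bar>\<close> with the harmonic
  measure of the arcs. Here an explicit majorant takes its place: for an arc of radius \<open>\<delta>\<close> about
  \<open>\<alpha>\<close> the real part of \<open>2\<delta> (a + z \<alpha>\<^sup>*) / (a - z \<alpha>\<^sup>*)\<close>, where \<open>a = 1 + \<delta>\<close> and \<open>\<alpha>\<^sup>*\<close> is the conjugate, is
  a multiple of the Poisson kernel of a slightly larger disc. It is non-negative on the unit disc, at
  least \<open>1\<close> on the arc, and at most \<open>6\<delta>\<close> for \<open>\<bar>z\<bar> \<le> 1/2\<close>. With \<open>q\<close> the sum of these functions, the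
  maximum principle applies to \<open>f exp (- ln (M/N) q)\<close>.
\<close>

lemma two_constants_arcs:
  fixes \<delta> M N :: real
  assumes hol: "f holomorphic_on ball 0 1" and cont: "continuous_on (cball 0 1) f"
    and I: "finite I" and \<delta>: "\<delta> > 0" and \<alpha>: "\<And>k. k \<in> I \<Longrightarrow> cmod (\<alpha> k) = 1"
    and N: "0 < N" "N \<le> M"
    and bd: "\<And>z. cmod z = 1 \<Longrightarrow> cmod (f z) \<le> M"
    and good: "\<And>z. cmod z = 1 \<Longrightarrow> (\<And>k. k \<in> I \<Longrightarrow> \<delta> < cmod (z - \<alpha> k)) \<Longrightarrow> cmod (f z) \<le> N"
    and s: "cmod s \<le> 1/2"
  shows "cmod (f s) \<le> N * exp (6 * (\<delta> * card I) * ln (M / N))"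
proof -
  define a where "a = 1 + \<delta>"
  define L where "L = ln (M / N)"
  have L: "L \<ge> 0" using N by (simp add: L_def)
  define p where "p k z = (of_real a + z * cnj (\<alpha> k)) / (of_real a - z * cnj (\<alpha> k))" for k z
  define q where "q z = (\<Sum>k\<in>I. of_real (2 * \<delta>) * p k z)" for z
  have au: "of_real a - z * cnj (\<alpha> k) \<noteq> 0" if "cmod z \<le> 1" "k \<in> I" for z k
  proof
    assume "of_real a - z * cnj (\<alpha> k) = 0"
    then have "cmod (of_real a) = cmod (z * cnj (\<alpha> k))" by simp
    then have "\<bar>a\<bar> = cmod z" using \<alpha>[OF that(2)] by (simp only: norm_mult norm_of_real complex_mod_cnj)
    then show False using that \<delta> by (simp add: a_def)
  qed
  have Re_p: "Re (p k z) = (a^2 - (cmod (z * cnj (\<alpha> k)))^2) / (cmod (of_real a - z * cnj (\<alpha> k)))^2" for k z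
  proof -
    have "Re ((of_real a + u) / (of_real a - u)) = (a^2 - (cmod u)^2) / (cmod (of_real a - u))^2" for u
      by (simp add: Re_divide cmod_power2) (simp add: power2_eq_square algebra_simps)
    then show ?thesis unfolding p_def .
  qed
  have Re_p_nonneg: "Re (p k z) \<ge> 0" if "cmod z \<le> 1" "k \<in> I" for z k
  proof -
    have "(cmod (z * cnj (\<alpha> k)))^2 \<le> 1^2"
      using that \<alpha>[of k] by (intro power_mono) (auto simp: norm_mult)
    also have "\<dots> \<le> a^2" using \<delta> by (intro power_mono) (auto simp: a_def)
    finally show ?thesis unfolding Re_p by (intro divide_nonneg_nonneg) auto
  qed
  have Re_p_arc: "2 * \<delta> * Re (p k z) \<ge> 1" if z: "cmod z = 1" "k \<in> I" "cmod (z - \<alpha> k) \<le> \<delta>" for z k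
  proof -
    have "\<alpha> k * cnj (\<alpha> k) = 1" using \<alpha>[OF z(2)] by (metis complex_norm_square of_real_1 one_power2)
    then have "of_real a - z * cnj (\<alpha> k) = of_real \<delta> - (z - \<alpha> k) * cnj (\<alpha> k)"
      by (simp add: a_def algebra_simps)
    then have "cmod (of_real a - z * cnj (\<alpha> k)) \<le> cmod (of_real \<delta>) + cmod ((z - \<alpha> k) * cnj (\<alpha> k))"
      by (metis norm_triangle_ineq4)
    also have "\<dots> \<le> 2 * \<delta>" using z \<alpha>[OF z(2)] \<delta> by (simp add: norm_mult)
    finally have *: "(cmod (of_real a - z * cnj (\<alpha> k)))^2 \<le> (2 * \<delta>)^2"
      by (intro power_mono) auto
    have "cmod (of_real a - z * cnj (\<alpha> k)) > 0" using au[of z k] z by simp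
    moreover have "a^2 - (cmod (z * cnj (\<alpha> k)))^2 = 2 * \<delta> + \<delta>^2"
      using z \<alpha>[OF z(2)] by (simp add: norm_mult a_def power2_eq_square algebra_simps)
    ultimately have "2 * \<delta> * Re (p k z) = 2 * \<delta> * (2 * \<delta> + \<delta>^2) / (cmod (of_real a - z * cnj (\<alpha> k)))^2"
      unfolding Re_p by simp
    moreover have "(2*\<delta>)^2 \<le> 2 * \<delta> * (2 * \<delta> + \<delta>^2)"
      using \<delta> by (simp add: power2_eq_square algebra_simps)
    ultimately show ?thesis
      using * \<open>cmod (of_real a - z * cnj (\<alpha> k)) > 0\<close>
      by (metis le_divide_eq_1_pos order_trans zero_less_power)
  qed
  have Re_p_centre: "Re (p k s) \<le> 3" if "k \<in> I" for k
  proof -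
    have u: "cmod (s * cnj (\<alpha> k)) \<le> 1/2" using s \<alpha>[OF that] by (simp add: norm_mult)
    have "cmod (of_real a + s * cnj (\<alpha> k)) \<le> cmod (of_real a) + cmod (s * cnj (\<alpha> k))"
      by (rule norm_triangle_ineq)
    moreover have "cmod (of_real a) = a" using \<delta> by (simp only: norm_of_real a_def)
    ultimately have 1: "cmod (of_real a + s * cnj (\<alpha> k)) \<le> a + 1/2" using u by linarith
    have "cmod (of_real a) - cmod (s * cnj (\<alpha> k)) \<le> cmod (of_real a - s * cnj (\<alpha> k))"
      by (rule norm_triangle_ineq2)
    then have 2: "a - 1/2 \<le> cmod (of_real a - s * cnj (\<alpha> k))" using u \<open>cmod (of_real a) = a\<close> by linarith
    have "Re (p k s) \<le> cmod (p k s)" by (rule complex_Re_le_cmod)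
    also have "\<dots> \<le> (a + 1/2) / (a - 1/2)"
      unfolding p_def norm_divide using 1 2 \<delta> by (intro frac_le) (auto simp: a_def)
    also have "\<dots> \<le> 3" using \<delta> by (simp add: a_def field_simps)
    finally show ?thesis .
  qed
  have Re_q: "Re (q z) = (\<Sum>k\<in>I. 2 * \<delta> * Re (p k z))" for z
    by (simp add: q_def)
  define F where "F z = f z * exp (- of_real L * q z)" for z
  have norm_F: "cmod (F z) = cmod (f z) * exp (- L * Re (q z))" for z
    by (simp add: F_def norm_mult)
  have cq: "continuous_on (cball 0 1) q" and hq: "q holomorphic_on ball 0 1"
    unfolding q_def p_def using au
    by (auto intro!: continuous_intros holomorphic_intros)
  have "cmod (F s) \<le> N"
  proof (rule maximum_modulus_frontier[where f = F and S = "cball 0 1"])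
    show "F holomorphic_on interior (cball 0 1)"
      unfolding F_def interior_cball using hol hq by (intro holomorphic_intros)
    show "continuous_on (closure (cball 0 1)) F"
      unfolding F_def using cont cq by (auto intro!: continuous_intros)
    fix z :: complex assume "z \<in> frontier (cball 0 1)"
    then have z: "cmod z = 1" by (simp add: frontier_cball)
    have qz: "Re (q z) \<ge> 0"
      unfolding Re_q using \<delta> Re_p_nonneg z by (intro sum_nonneg) auto
    show "cmod (F z) \<le> N"
    proof (cases "\<exists>k\<in>I. cmod (z - \<alpha> k) \<le> \<delta>")
      case True
      then obtain k where k: "k \<in> I" "cmod (z - \<alpha> k) \<le> \<delta>" by blast
      have "1 \<le> 2 * \<delta> * Re (p k z)" using Re_p_arc z k by blast
      also have "\<dots> \<le> Re (q z)"
        unfolding Re_q using I k(1) \<delta> Re_p_nonneg z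
        by (intro member_le_sum) auto
      finally have "exp (- L * Re (q z)) \<le> exp (- L)"
        using L by (simp add: mult_left_mono[of 1 _ L, simplified])
      then have "cmod (F z) \<le> M * exp (- L)"
        unfolding norm_F using bd[OF z] N by (intro mult_mono) auto
      also have "\<dots> = N" using N by (simp add: L_def exp_minus)
      finally show ?thesis .
    next
      case False
      then have "cmod (f z) \<le> N" using good[OF z] by force
      moreover have "exp (- L * Re (q z)) \<le> 1" using L qz by simp
      ultimately have "cmod (f z) * exp (- L * Re (q z)) \<le> N * 1"
        using N by (intro mult_mono) auto
      then show ?thesis by (simp add: norm_F)
    qed
  qed (use s in auto)
  have "Re (q s) \<le> (\<Sum>k\<in>I. 2 * \<delta> * 3)"
    unfolding Re_q using Re_p_centre \<delta> by (intro sum_mono) auto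
  then have "L * Re (q s) \<le> 6 * (\<delta> * card I) * L"
    using L mult_left_mono[of "Re (q s)" "6 * (\<delta> * card I)" L] by (simp add: mult.commute mult.left_commute)
  have "cmod (f s) = cmod (F s) * exp (L * Re (q s))"
    by (simp add: norm_F mult.assoc flip: exp_add)
  also have "\<dots> \<le> N * exp (6 * (\<delta> * card I) * L)"
    using \<open>cmod (F s) \<le> N\<close> \<open>L * Re (q s) \<le> _\<close> N by (intro mult_mono) auto
  finally show ?thesis by (simp add: L_def)
qed

lemma norm_cis_diff_le: "cmod (cis x - cis y) \<le> \<bar>x - y\<bar>"
proof -
  have "cis x - cis y = cis y * (cis (x - y) - 1)"
    by (simp add: algebra_simps cis_mult)
  then have "cmod (cis x - cis y) = 2 * \<bar>sin ((x - y) / 2)\<bar>"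
    using dist_exp_i_1[of "x - y"] by (simp add: norm_mult cis_conv_exp)
  then show ?thesis using abs_sin_x_le_abs_x[of "(x - y) / 2"] by simp
qed

text \<open>
  The sets where the pointwise supremum exceeds \<open>N\<close> decrease to the empty set as \<open>N\<close> grows.
\<close>

lemma small_exceptional_set:
  fixes g :: "nat \<Rightarrow> real \<Rightarrow> real"
  assumes cont: "\<And>n. continuous_on UNIV (g n)" and "0 < \<kappa>"
    and pw: "\<And>\<theta>. \<theta> \<in> {a..b} \<Longrightarrow> \<exists>B. \<forall>n. g n \<theta> \<le> B"
  shows "\<exists>N::nat. measure lborel {\<theta>\<in>{a..b}. \<exists>n. real N < g n \<theta>} < \<kappa>"
proof -
  define G where "G N = {\<theta>\<in>{a..b}. \<exists>n. real N < g n \<theta>}" for N :: nat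
  have "G N = {a..b} \<inter> (\<Union>n. {\<theta>. real N < g n \<theta>})" for N
    by (auto simp: G_def)
  moreover have "open {\<theta>. real N < g n \<theta>}" for N n
    using cont by (intro open_Collect_less continuous_intros) auto
  ultimately have meas: "G N \<in> sets lborel" for N by auto
  have fin: "emeasure lborel (G N) \<noteq> \<infinity>" for N
  proof -
    have "emeasure lborel (G N) \<le> emeasure lborel {a..b}"
      by (intro emeasure_mono) (auto simp: G_def)
    also have "\<dots> < \<infinity>" by (simp add: emeasure_lborel_Icc_eq)
    finally show ?thesis by simp
  qed
  have "decseq G"
    unfolding decseq_def G_def by (auto, meson le_less_trans of_nat_le_iff)
  moreover have "(\<Inter>N. G N) = {}"
  proof -
    have "\<exists>N. \<theta> \<notin> G N" for \<theta>
    proof (cases "\<theta> \<in> {a..b}")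
      case True
      then obtain B where "\<forall>n. g n \<theta> \<le> B" using pw by blast
      moreover obtain N where "B \<le> real N" using real_arch_simple by blast
      ultimately have "g n \<theta> \<le> real N" for n by (meson order_trans)
      then show ?thesis by (intro exI[of _ N]) (simp add: G_def not_less)
    qed (auto simp: G_def)
    then show ?thesis by blast
  qed
  ultimately have "(\<lambda>N. measure lborel (G N)) \<longlonglongrightarrow> 0"
    using Lim_measure_decseq[of G lborel] meas fin by auto
  then have "\<forall>\<^sub>F N in sequentially. measure lborel (G N) < \<kappa>"
    using \<open>0 < \<kappa>\<close> by (simp add: order_tendstoD(2))
  then show ?thesis unfolding G_def by (meson eventually_sequentially order_refl)
qed

text \<open>
  Passing from measure to arcs: an open set of small measure need not be covered by finitely many
  arcs of small total length. But if the interval is cut into equal pieces so short that \<open>u\<close> varies by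
  less than \<open>c' - c\<close> on each, then every piece on which \<open>u\<close> exceeds \<open>c'\<close> somewhere lies in \<open>G\<close>, and the
  total length of these pieces is at most the measure of \<open>G\<close>.
\<close>

lemma arc_cover_of_superlevel_set:
  fixes u :: "real \<Rightarrow> real"
  assumes cont: "continuous_on UNIV u" and "G \<in> sets lborel" "G \<subseteq> {0..2*pi}"
    and G: "\<And>\<theta>. \<theta> \<in> {0..2*pi} \<Longrightarrow> c < u \<theta> \<Longrightarrow> \<theta> \<in> G" and c: "c < c'"
  obtains \<delta> :: real and I and \<beta> :: "nat \<Rightarrow> real" where "\<delta> > 0" "finite I" "\<delta> * card I \<le> measure lborel G"
    "\<And>\<theta>. 0 \<le> \<theta> \<Longrightarrow> \<theta> < 2*pi \<Longrightarrow> c' < u \<theta> \<Longrightarrow> \<exists>k\<in>I. \<bar>\<theta> - \<beta> k\<bar> \<le> \<delta>"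
proof -
  have "uniformly_continuous_on {0..2*pi} u"
    using cont by (intro compact_uniformly_continuous) (auto intro: continuous_on_subset)
  then obtain d where d: "d > 0"
    "\<And>x y. x \<in> {0..2*pi} \<Longrightarrow> y \<in> {0..2*pi} \<Longrightarrow> dist y x < d \<Longrightarrow> dist (u y) (u x) < c' - c"
    unfolding uniformly_continuous_on_def using c by (metis diff_gt_0_iff_gt)
  obtain m :: nat where m: "2 * pi / d < real m" using reals_Archimedean2 by blast
  have "0 < 2 * pi / d" using d by simp
  then have m0: "m > 0" using m by (metis less_trans of_nat_0_less_iff)
  define \<delta> where "\<delta> = 2 * pi / m"
  have \<delta>: "\<delta> > 0" "\<delta> < d" "\<delta> * m = 2 * pi"
    using m m0 d by (auto simp: \<delta>_def field_simps)
  define J where "J k = {\<delta> * real k ..< \<delta> * (real k + 1)}" for k :: nat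
  define I where "I = {k. k < m \<and> (\<exists>\<theta>\<in>J k. c' < u \<theta>)}"
  have finI: "finite I" by (simp add: I_def)
  have J2pi: "J k \<subseteq> {0..2*pi}" if "k < m" for k
  proof -
    have "\<delta> * (real k + 1) \<le> \<delta> * real m" using that \<delta> by (intro mult_left_mono) auto
    then show ?thesis using \<delta> by (auto simp: J_def)
       (meson \<delta>(1) mult_nonneg_nonneg of_nat_0_le_iff order_less_imp_le order_trans)
  qed
  have JG: "J k \<subseteq> G" if k: "k \<in> I" for k
  proof
    fix \<theta> assume \<theta>: "\<theta> \<in> J k"
    obtain \<theta>' where \<theta>': "\<theta>' \<in> J k" "c' < u \<theta>'" using k by (auto simp: I_def)
    have mem: "\<theta> \<in> {0..2*pi}" "\<theta>' \<in> {0..2*pi}"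
      using \<theta> \<theta>'(1) J2pi[of k] k by (auto simp: I_def)
    have "dist \<theta> \<theta>' < d" using \<theta> \<theta>' \<delta> by (auto simp: J_def dist_real_def algebra_simps)
    then have "dist (u \<theta>) (u \<theta>') < c' - c"
      using d(2)[OF mem(2,1)] by blast
    then have "c < u \<theta>" using \<theta>' by (simp add: dist_real_def)
    then show "\<theta> \<in> G" using G mem by blast
  qed
  have Jfloor: "k = nat \<lfloor>\<theta> / \<delta>\<rfloor>" if "\<theta> \<in> J k" for k \<theta>
  proof -
    have "real k \<le> \<theta> / \<delta>" "\<theta> / \<delta> < real k + 1"
      using that \<delta>(1) by (auto simp: J_def field_simps)
    then have "\<lfloor>\<theta> / \<delta>\<rfloor> = int k" by (intro floor_unique) auto
    then show ?thesis by simp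
  qed
  have "\<delta> * card I = (\<Sum>k\<in>I. measure lborel (J k))"
    using \<delta> by (simp add: J_def algebra_simps)
  also have "\<dots> = measure lborel (\<Union>k\<in>I. J k)"
  proof (rule measure_finite_Union[symmetric])
    show "disjoint_family_on J I"
      unfolding disjoint_family_on_def using Jfloor by blast
    show "emeasure lborel (J k) \<noteq> \<infinity>" for k
    proof -
      have "\<delta> * real k \<le> \<delta> * (real k + 1)" using \<delta>(1) by (intro mult_left_mono) auto
      then show ?thesis unfolding J_def by simp
    qed
  qed (auto simp: finI J_def)
  also have "\<dots> \<le> measure lborel G"
  proof (rule measure_mono_fmeasurable)
    have "emeasure lborel G \<le> emeasure lborel {0..2*pi}"
      using assms by (intro emeasure_mono) auto
    also have "\<dots> < \<infinity>" by (simp add: emeasure_lborel_Icc_eq)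
    finally show "G \<in> fmeasurable lborel" using assms by (simp add: fmeasurable_def)
    show "(\<Union>k\<in>I. J k) \<in> sets lborel"
      using finI by (intro sets.finite_UN) (auto simp: J_def)
  qed (use JG in auto)
  finally have card: "\<delta> * card I \<le> measure lborel G" .
  have "\<exists>k\<in>I. \<bar>\<theta> - \<delta> * real k\<bar> \<le> \<delta>" if \<theta>: "0 \<le> \<theta>" "\<theta> < 2*pi" "c' < u \<theta>" for \<theta>
  proof -
    define k where "k = nat \<lfloor>\<theta> / \<delta>\<rfloor>"
    have k: "real k = of_int \<lfloor>\<theta> / \<delta>\<rfloor>" using \<theta> \<delta> by (simp add: k_def)
    have "real k \<le> \<theta> / \<delta>" "\<theta> / \<delta> < real k + 1" unfolding k by linarith+
    then have b: "\<delta> * real k \<le> \<theta>" "\<theta> < \<delta> * (real k + 1)" using \<delta>(1) by (auto simp: field_simps)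
    then have "\<delta> * real k < \<delta> * real m" using \<theta> \<delta> by linarith
    then have "k < m" using \<delta>(1) by simp
    then have "k \<in> I" using b \<theta> by (auto simp: I_def J_def)
    moreover have "\<bar>\<theta> - \<delta> * real k\<bar> \<le> \<delta>" using b by (simp add: algebra_simps)
    ultimately show ?thesis by blast
  qed
  then show thesis using that[of \<delta> I "\<lambda>k. \<delta> * real k"] \<delta>(1) finI card by blast
qed

text \<open>
  For large \<open>N\<close> the points of the circle at which some \<open>g\<^sub>n\<close> exceeds \<open>N\<close> form a set of measure less
  than a prescribed \<open>\<kappa>\<close>. This one set serves all \<open>n\<close>, so the two-constants estimate bounds every
  \<open>g\<^sub>n\<close> on the half disc by \<open>N + 1\<close> times the \<open>6\<kappa>\<close>-th power of \<open>C A\<^sup>n\<close>; the choice of \<open>\<kappa>\<close> makes the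
  \<open>6\<kappa>\<close>-th power of \<open>A\<close> equal to \<open>\<eta>\<close>.
\<close>

lemma hartogs_lemma:
  fixes g :: "nat \<Rightarrow> complex \<Rightarrow> complex"
  assumes hol: "\<And>n. g n holomorphic_on ball 0 1" and cont: "\<And>n. continuous_on (cball 0 1) (g n)"
    and bd: "\<And>n z. cmod z = 1 \<Longrightarrow> cmod (g n z) \<le> C * A ^ n"
    and pw: "\<And>z. cmod z = 1 \<Longrightarrow> \<exists>B. \<forall>n. cmod (g n z) \<le> B"
    and \<eta>: "\<eta> > 1"
  shows "\<exists>B. \<forall>n s. cmod s \<le> 1/2 \<longrightarrow> cmod (g n s) \<le> B * \<eta> ^ n"
proof -
  (* enlarged constants, so that ln A' > 0 and the bound C' * A' ^ n is at least 1 *)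
  define A' where "A' = max A 2"
  define C' where "C' = max C 1"
  have A': "A' > 1" and C': "C' \<ge> 1" by (auto simp: A'_def C'_def)
  have bd': "cmod (g n z) \<le> C' * A' ^ n" if "cmod z = 1" for n z
  proof -
    have "0 \<le> C * A ^ n" for n using bd[of 1 n] norm_ge_zero[of "g n 1"] by (simp del: norm_ge_zero)
    from this[of 0] this[of 1] have C0: "C \<ge> 0" and "0 \<le> C * A" by auto
    show ?thesis
    proof (cases "C = 0")
      case True
      then show ?thesis using bd[OF that, of n] A' C' by simp
    next
      case False
      then have "A \<ge> 0" using C0 \<open>0 \<le> C * A\<close> by (simp add: zero_le_mult_iff)
      then have "C * A ^ n \<le> C' * A' ^ n"
        using C0 by (intro mult_mono power_mono) (auto simp: A'_def C'_def)
      then show ?thesis using bd[OF that, of n] by linarith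
    qed
  qed
  define \<kappa> where "\<kappa> = ln \<eta> / (6 * ln A')"
  have lnA: "ln A' > 0" using A' by simp
  have \<kappa>: "\<kappa> > 0" "6 * \<kappa> * ln A' = ln \<eta>" using \<eta> lnA by (auto simp: \<kappa>_def)
  define u where "u n \<theta> = cmod (g n (cis \<theta>))" for n \<theta>
  have cont_u: "continuous_on UNIV (u n)" for n
    unfolding u_def
    by (intro continuous_intros continuous_on_compose2[OF cont]) auto
  have "\<exists>N::nat. measure lborel {\<theta>\<in>{0..2*pi}. \<exists>n. real N < u n \<theta>} < \<kappa>"
    using small_exceptional_set[of u \<kappa> 0 "2*pi"] cont_u \<kappa>(1) pw by (simp add: u_def)
  then obtain N :: nat where N: "measure lborel {\<theta>\<in>{0..2*pi}. \<exists>n. real N < u n \<theta>} < \<kappa>" by blast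
  define G where "G = {\<theta>\<in>{0..2*pi}. \<exists>n. real N < u n \<theta>}"
  have "G = {0..2*pi} \<inter> (\<Union>n. {\<theta>. real N < u n \<theta>})" by (auto simp: G_def)
  moreover have "open {\<theta>. real N < u n \<theta>}" for n
    using cont_u by (intro open_Collect_less continuous_intros) auto
  ultimately have Gm: "G \<in> sets lborel" by auto
  define N' where "N' = real N + 1"
  have N': "N' \<ge> 1" by (simp add: N'_def)
  have "cmod (g n s) \<le> N' * exp (6 * \<kappa> * ln C') * \<eta> ^ n" if s: "cmod s \<le> 1/2" for n s
  proof -
    have inG: "\<theta> \<in> G" if "\<theta> \<in> {0..2*pi}" "real N < u n \<theta>" for \<theta>
      using that by (auto simp: G_def)
    have G2pi: "G \<subseteq> {0..2*pi}" by (auto simp: G_def)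
    have NN': "real N < N'" by (simp add: N'_def)
    obtain \<delta> :: real and I and \<beta> :: "nat \<Rightarrow> real"
      where \<delta>: "\<delta> > 0" and I: "finite I" "\<delta> * card I \<le> measure lborel G"
      and arcs: "\<And>\<theta>. 0 \<le> \<theta> \<Longrightarrow> \<theta> < 2*pi \<Longrightarrow> N' < u n \<theta> \<Longrightarrow> \<exists>k\<in>I. \<bar>\<theta> - \<beta> k\<bar> \<le> \<delta>"
      using arc_cover_of_superlevel_set[OF cont_u Gm G2pi inG NN', of n] by blast
    define M where "M = N' * (C' * A' ^ n)"
    have CA: "C' * A' ^ n \<ge> 1" using C' A' by (metis less_imp_le mult_ge1_I one_le_power)
    have "cmod (g n s) \<le> N' * exp (6 * (\<delta> * card I) * ln (M / N'))"
    proof (rule two_constants_arcs[where f = "g n" and s = s and \<alpha> = "\<lambda>k. cis (\<beta> k)"])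
      show "N' \<le> M" using N' CA by (simp add: M_def)
      show "cmod (g n z) \<le> M" if "cmod z = 1" for z
      proof -
        have "C' * A' ^ n \<le> M"
          using mult_right_mono[OF N', of "C' * A' ^ n"] CA by (simp add: M_def)
        then show ?thesis using bd'[OF that, of n] by linarith
      qed
      show "cmod (g n z) \<le> N'"
        if z: "cmod z = 1" and far: "\<And>k. k \<in> I \<Longrightarrow> \<delta> < cmod (z - cis (\<beta> k))" for z
      proof (rule ccontr)
        assume big: "\<not> cmod (g n z) \<le> N'"
        obtain \<theta> where \<theta>: "0 \<le> \<theta>" "\<theta> < 2*pi" "z = cis \<theta>"
          using z Arg2pi[of z] by (metis Arg2pi_eq_iff complex_norm_eq_1_exp cis_conv_exp mult.commute)
        then obtain k where "k \<in> I" "\<bar>\<theta> - \<beta> k\<bar> \<le> \<delta>" using arcs[of \<theta>] big by (auto simp: u_def)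
        then show False using far[of k] norm_cis_diff_le[of \<theta> "\<beta> k"] \<theta> by simp
      qed
    qed (use hol cont I \<delta> N' s in auto)
    also have "M / N' = C' * A' ^ n" using N' by (simp add: M_def)
    also have "exp (6 * (\<delta> * card I) * ln (C' * A' ^ n)) \<le> exp (6 * \<kappa> * ln (C' * A' ^ n))"
    proof -
      have "\<delta> * card I \<le> \<kappa>" using I(2) N unfolding G_def by linarith
      then have "6 * (\<delta> * card I) * ln (C' * A' ^ n) \<le> 6 * \<kappa> * ln (C' * A' ^ n)"
        using CA by (intro mult_right_mono) auto
      then show ?thesis using N' by simp
    qed
    also have "6 * \<kappa> * ln (C' * A' ^ n) = 6 * \<kappa> * ln C' + n * ln \<eta>"
      using C' A' \<kappa>(2) by (simp add: ln_mult ln_realpow distrib_left)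
    also have "exp \<dots> = exp (6 * \<kappa> * ln C') * \<eta> ^ n"
      using \<eta> by (simp add: exp_add exp_of_nat_mult)
    finally show ?thesis using N' by (simp add: mult.assoc)
  qed
  then show ?thesis by blast
qed

section \<open>Hartogs' theorem in two variables\<close>

text \<open>
  Baire's theorem for the sets \<open>E N\<close> of those \<open>t\<close> in a closed disc with \<open>\<bar>\<phi>(s,t)\<bar> \<le> N\<close> for all
  \<open>\<bar>s\<bar> \<le> \<rho>\<close>. They are closed by continuity in \<open>t\<close>, and they cover the disc by continuity in \<open>s\<close>.
\<close>

lemma separately_holomorphic_bounded_slab:
  assumes sep: "separately_holomorphic (ball 0 R) (ball 0 R) \<phi>"
    and "0 < r" "r < R" "\<rho> < R"
  obtains b \<epsilon> C where "\<epsilon> > 0" "ball b \<epsilon> \<subseteq> ball 0 r"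
    "\<And>s t. s \<in> cball 0 \<rho> \<Longrightarrow> t \<in> ball b \<epsilon> \<Longrightarrow> cmod (\<phi> s t) \<le> C"
proof -
  define S :: "complex set" where "S = cball 0 r"
  define E where "E N = {t\<in>S. \<forall>s\<in>cball 0 \<rho>. cmod (\<phi> s t) \<le> real N}" for N :: nat
  have SR: "S \<subseteq> ball 0 R" and \<rho>R: "cball 0 \<rho> \<subseteq> ball (0::complex) R"
    using assms by (auto simp: S_def)
  have "closed {t\<in>S. cmod (\<phi> s t) \<le> real N}" if "s \<in> cball 0 \<rho>" for s N
  proof -
    have "continuous_on (ball 0 R) (\<phi> s)"
      using sep subsetD[OF \<rho>R that]
      by (simp add: separately_holomorphic_def holomorphic_on_imp_continuous_on)
    then have "continuous_on S (\<lambda>t. cmod (\<phi> s t))"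
      using SR by (intro continuous_on_norm) (rule continuous_on_subset)
    then have "closed (S \<inter> (\<lambda>t. cmod (\<phi> s t)) -` {..real N})"
      by (intro continuous_closed_preimage) (auto simp: S_def)
    then show ?thesis by (simp add: Int_def vimage_def)
  qed
  then have "closed (S \<inter> (\<Inter>s\<in>cball 0 \<rho>. {t\<in>S. cmod (\<phi> s t) \<le> real N}))" for N
    by (intro closed_Int closed_INT) (auto simp: S_def)
  moreover have "E N = S \<inter> (\<Inter>s\<in>cball 0 \<rho>. {t\<in>S. cmod (\<phi> s t) \<le> real N})" for N
    by (auto simp: E_def)
  ultimately have closed_E: "closed (E N)" for N by simp
  have cover: "\<exists>N. t \<in> E N" if "t \<in> S" for t
  proof -
    have "continuous_on (ball 0 R) (\<lambda>s. \<phi> s t)"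
      using sep subsetD[OF SR that]
      by (simp add: separately_holomorphic_def holomorphic_on_imp_continuous_on)
    then have "compact ((\<lambda>s. \<phi> s t) ` cball 0 \<rho>)"
      using \<rho>R by (intro compact_continuous_image) (auto intro: continuous_on_subset)
    then obtain B where "\<forall>s\<in>cball 0 \<rho>. cmod (\<phi> s t) \<le> B"
      using compact_imp_bounded bounded_iff by (metis imageI)
    moreover obtain N where "B \<le> real N" using real_arch_simple by blast
    ultimately have "t \<in> E N" using that by (auto simp: E_def intro: order_trans)
    then show ?thesis ..
  qed
  have "\<exists>N b \<epsilon>. \<epsilon> > 0 \<and> ball b \<epsilon> \<subseteq> E N \<inter> ball 0 r"
  proof (rule ccontr)
    assume neg: "\<not> ?thesis"
    have "S \<subseteq> closure (\<Inter>(range (\<lambda>N. S - E N)))"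
    proof (rule Baire)
      show "closed S" by (simp add: S_def)
      show "countable (range (\<lambda>N. S - E N))" by simp
      fix T assume "T \<in> range (\<lambda>N. S - E N)"
      then obtain N where T: "T = S - E N" by blast
      have "S - E N = S \<inter> - E N" by blast
      then have op: "openin (top_of_set S) T"
        unfolding T using closed_E by (auto simp: openin_open intro!: exI[of _ "- E N"])
      have "ball 0 r \<subseteq> closure T"
      proof
        fix t :: complex assume t: "t \<in> ball 0 r"
        show "t \<in> closure T"
        proof (rule ccontr)
          assume "t \<notin> closure T"
          then obtain e where e: "e > 0" "ball t e \<subseteq> - closure T"
            using open_contains_ball[of "- closure T"] by auto
          obtain e' where e': "e' > 0" "ball t e' \<subseteq> ball 0 r"
            using openE[OF open_ball t] by blast
          have "ball t (min e e') \<subseteq> E N \<inter> ball 0 r"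
          proof
            fix x assume x: "x \<in> ball t (min e e')"
            then have "x \<notin> T" "x \<in> ball 0 r"
              using e(2) e'(2) closure_subset[of T] by auto
            then show "x \<in> E N \<inter> ball 0 r" by (auto simp: T S_def)
          qed
          then show False using neg e(1) e'(1) by (meson min_less_iff_conj)
        qed
      qed
      then have "closure (ball 0 r) \<subseteq> closure T" by (simp add: closure_minimal)
      then show "openin (top_of_set S) T \<and> S \<subseteq> closure T"
        using op \<open>0 < r\<close> by (simp add: S_def)
    qed
    moreover have "\<Inter>(range (\<lambda>N. S - E N)) = {}" using cover by blast
    moreover have "0 \<in> S" using \<open>0 < r\<close> by (simp add: S_def)
    ultimately show False by (metis closure_empty empty_iff subsetD)
  qed
  then obtain N b \<epsilon> where "\<epsilon> > 0" "ball b \<epsilon> \<subseteq> E N \<inter> ball 0 r" by blast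
  then show thesis
    by (intro that[of \<epsilon> b "real N"]) (auto simp: E_def)
qed

lemma norm_taylor_coeff_le:
  assumes "f holomorphic_on S" and "cball b r \<subseteq> S" and "0 < r"
    and "\<And>t. t \<in> cball b r \<Longrightarrow> cmod (f t) \<le> B"
  shows "cmod ((deriv ^^ n) f b / fact n) \<le> B / r ^ n"
proof -
  have "cmod ((deriv ^^ n) f b) \<le> fact n * B / r ^ n"
  proof (rule Cauchy_inequality)
    show "f holomorphic_on ball b r"
      using assms ball_subset_cball by (meson holomorphic_on_subset)
    show "continuous_on (cball b r) f"
      using assms by (meson holomorphic_on_imp_continuous_on holomorphic_on_subset)
  qed (use assms in \<open>auto simp: dist_norm\<close>)
  then show ?thesis by (simp add: norm_divide field_simps)
qed

text \<open>
  The radii: the centre \<open>b\<close> of the slab satisfies \<open>\<bar>b\<bar> < R/8\<close>, so each \<open>\<phi>(s, \<cdot>)\<close> is holomorphic on a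
  neighbourhood of the closed disc of radius \<open>\<tau> = 3R/4\<close> about \<open>b\<close>, and the normalised Taylor
  coefficients \<open>\<tau>\<^sup>n c\<^sub>n(s)\<close> are bounded in \<open>n\<close> for each \<open>s\<close>. Hartogs' lemma with \<open>\<eta> = 2\<close> on the disc
  \<open>\<bar>s\<bar> \<le> R/4\<close> makes \<open>c\<^sub>n(s)\<close> uniformly of size \<open>(2/\<tau>)\<^sup>n\<close> for \<open>\<bar>s\<bar> \<le> R/8\<close>. For \<open>\<bar>t\<bar> < R/8\<close> one has
  \<open>\<bar>t - b\<bar> \<le> R/4\<close>, so the Taylor series is dominated by a geometric series of ratio \<open>2/3\<close>.
\<close>

theorem hartogs_locally_bounded:
  assumes sep: "separately_holomorphic (ball 0 R) (ball 0 R) \<phi>" and R: "0 < R"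
  obtains \<delta> C where "0 < \<delta>" "\<delta> < R" "\<And>s t. s \<in> ball 0 \<delta> \<Longrightarrow> t \<in> ball 0 \<delta> \<Longrightarrow> cmod (\<phi> s t) \<le> C"
proof -
  obtain b \<epsilon> C where \<epsilon>: "\<epsilon> > 0" "ball b \<epsilon> \<subseteq> ball 0 (R/8)"
    and slab: "\<And>s t. s \<in> cball 0 (R/2) \<Longrightarrow> t \<in> ball b \<epsilon> \<Longrightarrow> cmod (\<phi> s t) \<le> C"
  proof (rule separately_holomorphic_bounded_slab[OF sep, of "R/8" "R/2"])
  qed (use R in auto)
  have b: "cmod b < R/8" using \<epsilon> by (auto dest: subsetD[of _ _ b])
  define \<tau> where "\<tau> = 3 * R / 4"
  have \<tau>: "\<tau> > 0" using R by (simp add: \<tau>_def)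
  have sub: "cball b \<tau> \<subseteq> ball 0 R"
  proof
    fix t assume "t \<in> cball b \<tau>"
    then have "cmod (t - b) \<le> \<tau>" by (simp add: dist_norm norm_minus_commute)
    then show "t \<in> ball 0 R"
      using norm_triangle_ineq[of "t - b" b] b R by (simp add: \<tau>_def)
  qed
  have hol_t: "\<phi> s holomorphic_on ball 0 R" if "s \<in> ball 0 R" for s
    using sep that by (simp add: separately_holomorphic_def)
  define c where "c n s = (deriv ^^ n) (\<phi> s) b / fact n" for n s
  have hol_c: "c n holomorphic_on ball 0 (R/2)" for n
  proof -
    have "(\<lambda>s. (deriv ^^ n) (\<phi> s) b) holomorphic_on ball 0 (R/2)"
    proof (rule holomorphic_higher_partial_deriv[where T = "ball b \<epsilon>"])
      show "separately_holomorphic (ball 0 (R/2)) (ball b \<epsilon>) \<phi>"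
      proof (rule separately_holomorphic_subset[OF sep])
        show "ball b \<epsilon> \<subseteq> ball 0 R" using \<epsilon>(2) R by fastforce
      qed (use R in auto)
      show "\<exists>r>0. \<exists>C. \<forall>s\<in>ball 0 (R/2). \<forall>t'\<in>ball t r \<inter> ball b \<epsilon>. cmod (\<phi> s t') \<le> C"
        if "t \<in> ball b \<epsilon>" for t
        using slab by (intro exI[of _ 1] conjI exI[of _ C]) auto
    qed (use \<epsilon> in auto)
    then show ?thesis unfolding c_def by (intro holomorphic_intros) auto
  qed
  define g where "g n z = of_real (\<tau> ^ n) * c n (of_real (R/4) * z)" for n z
  have scale: "of_real (R/4) * z \<in> ball 0 (R/2)" if "cmod z \<le> 1" for z
    using that R mult_left_mono[of "cmod z" 1 R] by (simp add: norm_mult)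
  have hol_g': "g n holomorphic_on cball 0 1" for n
  proof -
    have "(c n \<circ> (\<lambda>z. of_real (R/4) * z)) holomorphic_on cball 0 1"
      by (rule holomorphic_on_compose_gen[OF _ hol_c]) (use scale in \<open>auto intro!: holomorphic_intros\<close>)
    then show ?thesis unfolding g_def o_def by (intro holomorphic_intros)
  qed
  have hol_g: "g n holomorphic_on ball 0 1" and cont_g: "continuous_on (cball 0 1) (g n)" for n
    using hol_g'[of n] ball_subset_cball
    by (blast intro: holomorphic_on_subset holomorphic_on_imp_continuous_on)+
  have g_bound: "cmod (g n z) \<le> B * (\<tau> / r) ^ n"
    if "cmod z = 1" "cball b r \<subseteq> ball 0 R" "0 < r"
      "\<And>t. t \<in> cball b r \<Longrightarrow> cmod (\<phi> (of_real (R/4) * z) t) \<le> B" for n z r B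
  proof -
    have "of_real (R/4) * z \<in> ball 0 R" using scale[of z] that(1) R by auto
    then have "cmod (c n (of_real (R/4) * z)) \<le> B / r ^ n"
      unfolding c_def using that by (intro norm_taylor_coeff_le[OF hol_t]) auto
    then have "\<tau> ^ n * cmod (c n (of_real (R/4) * z)) \<le> \<tau> ^ n * (B / r ^ n)"
      using \<tau> by (intro mult_left_mono) auto
    then show ?thesis using \<tau> by (simp add: g_def norm_mult power_divide norm_power mult.commute)
  qed
  have "\<exists>B. \<forall>n s. cmod s \<le> 1/2 \<longrightarrow> cmod (g n s) \<le> B * 2 ^ n"
  proof (rule hartogs_lemma[OF hol_g cont_g])
    have sub': "cball b (\<epsilon>/2) \<subseteq> ball b \<epsilon>" using \<epsilon> by auto
    have "ball b \<epsilon> \<subseteq> ball 0 R" using \<epsilon>(2) R by fastforce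
    with sub' have sub'': "cball b (\<epsilon>/2) \<subseteq> ball 0 R" by (rule order_trans)
    show "cmod (g n z) \<le> C * (\<tau> / (\<epsilon>/2)) ^ n" if "cmod z = 1" for n z
      using slab scale[of z] sub' sub'' \<epsilon>(1) that by (intro g_bound) auto
    show "\<exists>B. \<forall>n. cmod (g n z) \<le> B" if z: "cmod z = 1" for z
    proof -
      have "of_real (R/4) * z \<in> ball 0 R" using scale[of z] z R by auto
      then have "continuous_on (cball b \<tau>) (\<phi> (of_real (R/4) * z))"
        using hol_t sub by (meson holomorphic_on_imp_continuous_on holomorphic_on_subset)
      then have "compact (\<phi> (of_real (R/4) * z) ` cball b \<tau>)"
        by (intro compact_continuous_image) auto
      then obtain B where "\<forall>t\<in>cball b \<tau>. cmod (\<phi> (of_real (R/4) * z) t) \<le> B"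
        using compact_imp_bounded bounded_iff by (metis imageI)
      then have "cmod (g n z) \<le> B * (\<tau> / \<tau>) ^ n" for n
        using z sub \<tau> by (intro g_bound) auto
      then show ?thesis using \<tau> by auto
    qed
  qed auto
  then obtain B where B: "\<And>n s. cmod s \<le> 1/2 \<Longrightarrow> cmod (g n s) \<le> B * 2 ^ n" by blast
  have "cmod (g 0 0) \<le> B * 2 ^ 0" by (rule B) simp
  then have B0: "B \<ge> 0" using order_trans[OF norm_ge_zero] by fastforce
  have "cmod (\<phi> s t) \<le> B * 3" if s: "s \<in> ball 0 (R/8)" and t: "t \<in> ball 0 (R/8)" for s t
  proof -
    have sR: "s \<in> ball 0 R" using s R by simp
    have tb: "cmod (t - b) \<le> R/4" using t b norm_triangle_ineq4[of t b] by simp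
    have "ball b \<tau> \<subseteq> ball 0 R" using sub ball_subset_cball by blast
    then have "\<phi> s holomorphic_on ball b \<tau>" using hol_t[OF sR] holomorphic_on_subset by blast
    moreover have "t \<in> ball b \<tau>" using tb R by (simp add: \<tau>_def dist_norm norm_minus_commute)
    ultimately have "(\<lambda>n. c n s * (t - b) ^ n) sums \<phi> s t"
      unfolding c_def by (rule holomorphic_power_series)
    then have eq: "\<phi> s t = (\<Sum>n. c n s * (t - b) ^ n)" by (simp add: sums_iff)
    have "cmod (\<Sum>n. c n s * (t - b) ^ n) \<le> (\<Sum>n. B * (2/3::real) ^ n)"
    proof (rule norm_suminf_le)
      show "summable (\<lambda>n. B * (2/3::real) ^ n)" by (intro summable_mult summable_geometric) auto
      fix n
      define z where "z = s / of_real (R/4)"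
      have "cmod z \<le> 1/2" using s R by (simp add: z_def norm_divide field_simps)
      moreover have "of_real (R/4) * z = s" using R by (simp add: z_def)
      ultimately have "\<tau> ^ n * cmod (c n s) \<le> B * 2 ^ n"
        using B[of z n] \<tau> by (simp add: g_def norm_mult norm_power)
      then have c: "cmod (c n s) \<le> B * 2 ^ n / \<tau> ^ n" using \<tau> by (simp add: field_simps)
      have "cmod (c n s * (t - b) ^ n) \<le> (B * 2 ^ n / \<tau> ^ n) * (R/4) ^ n"
        unfolding norm_mult norm_power using c tb B0 \<tau> by (intro mult_mono power_mono) auto
      also have "\<dots> = B * (2 / \<tau> * (R/4)) ^ n" 
        unfolding power_mult_distrib[of "2 / \<tau>"] power_divide[of 2 \<tau>]
        by (simp only: mult.assoc times_divide_eq_left times_divide_eq_right)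
      also have "2 / \<tau> * (R/4) = 2/3" using R by (simp add: \<tau>_def field_simps)
      finally show "cmod (c n s * (t - b) ^ n) \<le> B * (2/3) ^ n" .
    qed
    also have "\<dots> = B * 3" by (simp add: suminf_mult suminf_geometric)
    finally show ?thesis by (simp add: eq)
  qed
  then show thesis using that[of "R/8" "B * 3"] R by simp
qed

text \<open>
  Write the mixed quotient as \<open>(q(h) - q(0))/h\<close> with \<open>q(s) = (\<phi>(s,h) - \<phi>(s,0))/h\<close>. On a fixed disc \<open>q\<close>
  differs from \<open>g(s) = \<partial>\<phi>/\<partial>t (s,0)\<close> by a holomorphic function of size \<open>O(\<bar>h\<bar>)\<close>, whose Lipschitz
  constant on a smaller disc is then \<open>O(\<bar>h\<bar>)\<close> too. So the mixed quotient has the same limit as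
  \<open>(g(h) - g(0))/h\<close>.
\<close>

theorem mixed_difference_quotient_tendsto:
  assumes sep: "separately_holomorphic (ball 0 R) (ball 0 R) \<phi>" and R: "0 < R"
  shows "\<exists>\<delta>>0. (\<lambda>s. deriv (\<phi> s) 0) holomorphic_on ball 0 \<delta>"
    and "((\<lambda>h. (\<phi> h h - \<phi> h 0 - \<phi> 0 h + \<phi> 0 0) / h^2) \<longlongrightarrow> deriv (\<lambda>s. deriv (\<phi> s) 0) 0) (at 0)"
proof -
  obtain \<delta> C where \<delta>: "0 < \<delta>" "\<delta> < R"
    and bd: "\<And>s t. s \<in> ball 0 \<delta> \<Longrightarrow> t \<in> ball 0 \<delta> \<Longrightarrow> cmod (\<phi> s t) \<le> C"
    using hartogs_locally_bounded[OF sep R] by blast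
  have sep': "separately_holomorphic (ball 0 \<delta>) (ball 0 \<delta>) \<phi>"
    using \<delta> by (intro separately_holomorphic_subset[OF sep]) auto
  define g where "g s = deriv (\<phi> s) 0" for s
  have hol_g: "g holomorphic_on ball 0 \<delta>"
    unfolding g_def by (rule holomorphic_partial_deriv[OF _ sep' bd \<delta>(1)]) auto
  then show "\<exists>\<delta>>0. (\<lambda>s. deriv (\<phi> s) 0) holomorphic_on ball 0 \<delta>"
    using \<delta>(1) by (auto simp: g_def[abs_def])
  define K where "K = 4 * (32 * C / \<delta>^2) / \<delta>"
  define err where "err h = (\<phi> h h - \<phi> h 0 - \<phi> 0 h + \<phi> 0 0) / h^2 - (g h - g 0) / h" for h
  have err: "cmod (err h) \<le> K * cmod h" if h: "h \<noteq> 0" "cmod h < \<delta>/4" for h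
  proof -
    define e where "e s = (\<phi> s h - \<phi> s 0) / h - g s" for s
    have e_bd: "cmod (e s) \<le> 32 * C / \<delta>^2 * cmod h" if "s \<in> ball 0 \<delta>" for s
    proof -
      have *: "cmod (\<phi> s (0 + h) - \<phi> s 0 - h * deriv (\<phi> s) 0) \<le> 32 * C / \<delta>^2 * (cmod h)^2"
        by (rule bounded_holomorphic_first_order_remainder)
           (use sep' bd that h in \<open>auto simp: separately_holomorphic_def\<close>)
      have "e s = (\<phi> s (0 + h) - \<phi> s 0 - h * deriv (\<phi> s) 0) / h"
        using h by (simp add: e_def g_def field_simps)
      then have "cmod (e s) = cmod (\<phi> s (0 + h) - \<phi> s 0 - h * deriv (\<phi> s) 0) / cmod h"
        by (simp only: norm_divide)
      also have "\<dots> \<le> 32 * C / \<delta>^2 * (cmod h)^2 / cmod h"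
        using * by (intro divide_right_mono) auto
      also have "\<dots> = 32 * C / \<delta>^2 * cmod h"
        using h by (simp add: power2_eq_square)
      finally show ?thesis .
    qed
    have "e holomorphic_on ball 0 \<delta>"
    proof -
      have "h \<in> ball 0 \<delta>" "0 \<in> ball 0 \<delta>" using h \<delta>(1) by auto
      then have "(\<lambda>s. \<phi> s h) holomorphic_on ball 0 \<delta>" "(\<lambda>s. \<phi> s 0) holomorphic_on ball 0 \<delta>"
        using sep' unfolding separately_holomorphic_def by blast+
      then show ?thesis unfolding e_def using h(1) hol_g by (intro holomorphic_intros) auto
    qed
    then have "cmod (e h - e 0) \<le> 4 * (32 * C / \<delta>^2 * cmod h) / \<delta> * cmod (h - 0)"
      by (rule bounded_holomorphic_lipschitz[OF _ e_bd]) (use h \<delta> in auto)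
    then have "cmod (e h - e 0) / cmod h \<le> 4 * (32 * C / \<delta>^2 * cmod h) / \<delta> * cmod (h - 0) / cmod h"
      by (intro divide_right_mono) auto
    also have "\<dots> = K * cmod h" using h by (simp add: K_def)
    finally have "cmod ((e h - e 0) / h) \<le> K * cmod h" by (simp only: norm_divide)
    moreover have "err h = (e h - e 0) / h"
      using h by (simp add: err_def e_def field_simps power2_eq_square)
    ultimately show ?thesis by simp
  qed
  have "(err \<longlongrightarrow> 0) (at 0)"
  proof (rule Lim_null_comparison)
    have "\<forall>\<^sub>F h in at (0::complex). h \<noteq> 0 \<and> cmod h < \<delta>/4"
      unfolding eventually_at using \<delta>(1) by (intro exI[of _ "\<delta>/4"]) auto
    then show "\<forall>\<^sub>F h in at 0. cmod (err h) \<le> K * cmod h"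
      by eventually_elim (use err in auto)
    have "((\<lambda>h::complex. K * cmod h) \<longlongrightarrow> K * cmod 0) (at 0)" by (intro tendsto_intros)
    then show "((\<lambda>h::complex. K * cmod h) \<longlongrightarrow> 0) (at 0)" by simp
  qed
  moreover have "((\<lambda>h. (g h - g 0) / h) \<longlongrightarrow> deriv g 0) (at 0)"
    using DERIV_D[OF holomorphic_derivI[OF hol_g open_ball, of 0]] \<delta>(1) by simp
  ultimately have "((\<lambda>h. err h + (g h - g 0) / h) \<longlongrightarrow> 0 + deriv g 0) (at 0)"
    by (rule tendsto_add)
  then show "((\<lambda>h. (\<phi> h h - \<phi> h 0 - \<phi> 0 h + \<phi> 0 0) / h^2) \<longlongrightarrow> deriv (\<lambda>s. deriv (\<phi> s) 0) 0) (at 0)"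
    by (simp add: err_def g_def[abs_def])
qed

section \<open>Non-negative definite matrices and the Schur product\<close>

lemma quad_form_restrict:
  assumes "finite I" "J \<subseteq> I" "\<And>k. k \<in> I - J \<Longrightarrow> v k = 0"
  shows "quad_form I A v = quad_form J A v"
proof -
  have "quad_form I A v = (\<Sum>k\<in>J. \<Sum>l\<in>I. cnj (v k) * A k l * v l)"
    unfolding quad_form_def using assms by (intro sum.mono_neutral_right) auto
  also have "\<dots> = quad_form J A v"
    unfolding quad_form_def using assms by (intro sum.cong refl sum.mono_neutral_right) auto
  finally show ?thesis .
qed

lemma quad_form_pair:
  assumes "finite I" "k \<in> I" "l \<in> I" "k \<noteq> l"
  shows "quad_form I A (\<lambda>m. if m = k then a else if m = l then b else 0)
    = cnj a * A k k * a + cnj a * A k l * b + cnj b * A l k * a + cnj b * A l l * b"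
proof -
  have "quad_form I A (\<lambda>m. if m = k then a else if m = l then b else 0)
      = quad_form {k, l} A (\<lambda>m. if m = k then a else if m = l then b else 0)"
    using assms by (intro quad_form_restrict) auto
  then show ?thesis using assms(4) by (simp add: quad_form_def)
qed

lemma nonneg_definite_diagonal:
  assumes "finite I" "nonneg_definite_matrix I A" "k \<in> I"
  shows "A k k \<in> \<real>" "0 \<le> Re (A k k)"
proof -
  have "quad_form I A (\<lambda>m. if m = k then 1 else 0) = quad_form {k} A (\<lambda>m. if m = k then 1 else 0)"
    using assms by (intro quad_form_restrict) auto
  then have "quad_form I A (\<lambda>m. if m = k then 1 else 0) = A k k"
    by (simp add: quad_form_def)
  then show "A k k \<in> \<real>" "0 \<le> Re (A k k)"
    using assms(2) unfolding nonneg_definite_matrix_def by metis+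
qed

text \<open>Polarisation: the form takes real values at \<open>(1, 1)\<close> and at \<open>(1, \<i>)\<close>.\<close>

lemma nonneg_definite_hermitian:
  assumes "finite I" "nonneg_definite_matrix I A" "k \<in> I" "l \<in> I"
  shows "A l k = cnj (A k l)"
proof (cases "k = l")
  case True
  then show ?thesis
    using nonneg_definite_diagonal(1)[OF assms(1,2,4)] by (simp add: Reals_cnj_iff)
next
  case False
  have "cnj a * A k k * a + cnj a * A k l * b + cnj b * A l k * a + cnj b * A l l * b \<in> \<real>" for a b
    using assms(2) quad_form_pair[OF assms(1,3,4) False, of A a b]
    unfolding nonneg_definite_matrix_def by metis
  from this[of 1 1] this[of 1 \<i>] show ?thesis
    using nonneg_definite_diagonal(1)[OF assms(1,2,3)] nonneg_definite_diagonal(1)[OF assms(1,2,4)]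
    by (simp add: complex_is_Real_iff complex_eq_iff)
qed

text \<open>
  At the vector with entries \<open>- t (A k l)\<close> at \<open>k\<close> and \<open>1\<close> at \<open>l\<close> the form has the value
  \<open>A l l - 2 t \<bar>A k l\<bar>\<^sup>2\<close>, which would be negative for large \<open>t\<close> unless \<open>A k l = 0\<close>.
\<close>

lemma nonneg_definite_zero_row:
  assumes "finite I" "nonneg_definite_matrix I A" "k \<in> I" "l \<in> I" and "A k k = 0"
  shows "A k l = 0"
proof (cases "k = l")
  case False
  define c where "c = (Re (A k l))^2 + (Im (A k l))^2"
  have "2 * t * c \<le> Re (A l l)" for t :: real
  proof -
    define a where "a = - of_real t * A k l"
    have "0 \<le> Re (quad_form I A (\<lambda>m. if m = k then a else if m = l then 1 else 0))"
      using assms(2) unfolding nonneg_definite_matrix_def by blast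
    also have "quad_form I A (\<lambda>m. if m = k then a else if m = l then 1 else 0)
        = cnj a * A k l + cnj (A k l) * a + A l l"
      unfolding quad_form_pair[OF assms(1,3,4) False]
      using assms(5) nonneg_definite_hermitian[OF assms(1-4)] by simp
    also have "\<dots> = of_real (- 2 * t * c) + A l l"
      unfolding a_def c_def by (simp add: complex_eq_iff power2_eq_square algebra_simps)
    finally show ?thesis by simp
  qed
  from this[of "(Re (A l l) + 1) / (2 * c)"] have "c = 0" by (cases "c = 0") auto
  then show ?thesis by (simp add: c_def complex_eq_iff sum_power2_eq_zero_iff)
qed (use assms in simp)

text \<open>
  Cholesky factorisation by induction on the index set: the Schur complement \<open>A'\<close> of the diagonal
  entry \<open>d\<close> at the new index \<open>i\<close> is again non-negative definite, because its form at \<open>v\<close> is the form of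
  \<open>A\<close> at the extension of \<open>v\<close> that minimises it. For \<open>d = 0\<close> the row of \<open>i\<close> vanishes, and then the
  convention \<open>x / 0 = 0\<close> makes the same formulas valid.
\<close>

lemma nonneg_definite_gram:
  assumes "finite I" "nonneg_definite_matrix I A"
  shows "\<exists>U. \<forall>k\<in>I. \<forall>l\<in>I. A k l = (\<Sum>r\<in>I. cnj (U r k) * U r l)"
  using assms
proof (induction I arbitrary: A rule: finite_induct)
  case empty
  then show ?case by simp
next
  case (insert i I)
  note fin = finite.insertI[OF insert.hyps(1), of i]
  define d where "d = A i i"
  have d: "cnj d = d" "0 \<le> Re d"
    using nonneg_definite_diagonal[OF fin insert.prems, of i] by (auto simp: d_def Reals_cnj_iff)
  have herm: "A l k = cnj (A k l)" if "k \<in> insert i I" "l \<in> insert i I" for k l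
    using nonneg_definite_hermitian[OF fin insert.prems that] .
  define A' where "A' k l = A k l - A k i * A i l / d" for k l
  have "nonneg_definite_matrix I A'"
    unfolding nonneg_definite_matrix_def
  proof
    fix v
    define S where "S = (\<Sum>l\<in>I. A i l * v l)"
    define w where "w = v(i := - S / d)"
    have cnjS: "(\<Sum>k\<in>I. cnj (v k) * A k i) = cnj S"
      unfolding S_def cnj_sum by (intro sum.cong refl) (simp add: herm[of i])
    have wI: "w k = v k" if "k \<in> I" for k using that insert.hyps(2) by (auto simp: w_def)
    have "(\<Sum>l\<in>I. cnj (w i) * A i l * w l) = cnj (w i) * S"
      using wI by (simp add: S_def sum_distrib_left mult.assoc)
    moreover have "(\<Sum>k\<in>I. cnj (w k) * A k i * w i) = cnj S * w i"
      using wI by (simp add: cnjS[symmetric] sum_distrib_right)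
    moreover have "quad_form I A w = quad_form I A v"
      using wI by (simp add: quad_form_def)
    ultimately have "quad_form (insert i I) A w
        = cnj (w i) * d * w i + cnj (w i) * S + cnj S * w i + quad_form I A v"
      using insert.hyps unfolding quad_form_def d_def by (simp add: sum.distrib)
    also have "\<dots> = quad_form I A v - cnj S * S / d"
      using d(1) by (cases "d = 0") (auto simp: w_def field_simps)
    also have "cnj S * S / d = (\<Sum>k\<in>I. \<Sum>l\<in>I. cnj (v k) * (A k i * A i l / d) * v l)"
      unfolding cnjS[symmetric] unfolding S_def sum_product sum_divide_distrib
      by (simp add: mult_ac)
    also have "quad_form I A v - \<dots> = quad_form I A' v"
      unfolding quad_form_def A'_def by (simp add: algebra_simps sum_subtractf)
    finally show "quad_form I A' v \<in> \<real> \<and> 0 \<le> Re (quad_form I A' v)"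
      using insert.prems unfolding nonneg_definite_matrix_def by metis
  qed
  then obtain U where U: "\<And>k l. k \<in> I \<Longrightarrow> l \<in> I \<Longrightarrow> A' k l = (\<Sum>r\<in>I. cnj (U r k) * U r l)"
    using insert.IH by blast
  define V where "V r k = (if r = i then A i k / of_real (sqrt (Re d)) else if k = i then 0 else U r k)" for r k
  have d_real: "of_real (Re d) = d" using d(1) by (simp add: complex_eq_iff)
  have sqrt: "complex_of_real (sqrt (Re d)) * of_real (sqrt (Re d)) = d"
    using d(2) d_real by (simp flip: of_real_mult)
  have first: "cnj (V i k) * V i l = A k i * A i l / d" if "k \<in> insert i I" for k l
    using sqrt herm[of i k] that by (simp add: V_def)
  have "A k l = (\<Sum>r\<in>insert i I. cnj (V r k) * V r l)" if k: "k \<in> insert i I" and l: "l \<in> insert i I" for k l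
  proof -
    have split: "(\<Sum>r\<in>insert i I. cnj (V r k) * V r l) = A k i * A i l / d + (\<Sum>r\<in>I. cnj (V r k) * V r l)"
      using insert.hyps first[OF k] by simp
    show ?thesis
    proof (cases "k = i \<or> l = i")
      case True
      have "(\<Sum>r\<in>I. cnj (V r k) * V r l) = 0"
        using True insert.hyps(2) by (intro sum.neutral) (auto simp: V_def)
      moreover have "A k l = A k i * A i l / d"
      proof (cases "d = 0")
        case True
        then have "A i m = 0" if "m \<in> insert i I" for m
          using nonneg_definite_zero_row[OF fin insert.prems insertI1 that] by (simp add: d_def)
        then show ?thesis using \<open>k = i \<or> l = i\<close> k l herm[of i k] by auto
      next
        case False
        then show ?thesis using \<open>k = i \<or> l = i\<close> by (auto simp: d_def)
      qed
      ultimately show ?thesis using split by simp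
    next
      case False
      then have "(\<Sum>r\<in>I. cnj (V r k) * V r l) = (\<Sum>r\<in>I. cnj (U r k) * U r l)"
        using insert.hyps(2) by (intro sum.cong) (auto simp: V_def)
      also have "\<dots> = A' k l" using U False k l by auto
      finally show ?thesis using split by (simp add: A'_def)
    qed
  qed
  then show ?case by blast
qed

text \<open>
  A Gram factorisation of \<open>A\<close> turns the form of the entrywise product into a sum of values of the
  form of \<open>B\<close>.
\<close>

lemma nonneg_definite_schur_product:
  assumes fin: "finite I" and A: "nonneg_definite_matrix I A" and B: "nonneg_definite_matrix I B"
  shows "nonneg_definite_matrix I (\<lambda>k l. A k l * B k l)"
  unfolding nonneg_definite_matrix_def
proof
  fix v
  obtain U where U: "\<And>k l. k \<in> I \<Longrightarrow> l \<in> I \<Longrightarrow> A k l = (\<Sum>r\<in>I. cnj (U r k) * U r l)"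
    using nonneg_definite_gram[OF fin A] by blast
  have "quad_form I (\<lambda>k l. A k l * B k l) v
      = (\<Sum>k\<in>I. \<Sum>l\<in>I. \<Sum>r\<in>I. cnj (U r k * v k) * B k l * (U r l * v l))"
    unfolding quad_form_def
    by (intro sum.cong refl) (simp add: U sum_distrib_left sum_distrib_right mult_ac)
  also have "\<dots> = (\<Sum>k\<in>I. \<Sum>r\<in>I. \<Sum>l\<in>I. cnj (U r k * v k) * B k l * (U r l * v l))"
    by (rule sum.cong[OF refl], rule sum.swap)
  also have "\<dots> = (\<Sum>r\<in>I. quad_form I B (\<lambda>k. U r k * v k))"
    unfolding quad_form_def by (rule sum.swap)
  finally show "quad_form I (\<lambda>k l. A k l * B k l) v \<in> \<real> \<and> 0 \<le> Re (quad_form I (\<lambda>k l. A k l * B k l) v)"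
    using B unfolding nonneg_definite_matrix_def by (simp add: sum_in_Reals sum_nonneg)
qed

lemma nonneg_definite_matrix_add:
  assumes "nonneg_definite_matrix I A" "nonneg_definite_matrix I B"
  shows "nonneg_definite_matrix I (\<lambda>k l. A k l + B k l)"
proof -
  have "quad_form I (\<lambda>k l. A k l + B k l) v = quad_form I A v + quad_form I B v" for v
    by (simp add: quad_form_def sum.distrib algebra_simps)
  then show ?thesis using assms by (auto simp: nonneg_definite_matrix_def)
qed

lemma pos_definite_imp_nonneg_definite_matrix:
  assumes "pos_definite_matrix I A"
  shows "nonneg_definite_matrix I A"
  unfolding nonneg_definite_matrix_def
proof
  fix v
  show "quad_form I A v \<in> \<real> \<and> 0 \<le> Re (quad_form I A v)"
  proof (cases "\<exists>k\<in>I. v k \<noteq> 0")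
    case True
    then show ?thesis using assms unfolding pos_definite_matrix_def by (meson less_imp_le)
  next
    case False
    then have "quad_form I A v = 0" by (simp add: quad_form_def)
    then show ?thesis by simp
  qed
qed

lemma pos_definite_imp_nonneg_definite_kernel:
  "pos_definite_kernel \<Omega> K \<Longrightarrow> nonneg_definite_kernel \<Omega> K"
  unfolding pos_definite_kernel_def nonneg_definite_kernel_def
  using pos_definite_imp_nonneg_definite_matrix by blast

text \<open>
  The points \<open>p k\<close> may coincide, while a kernel is tested on sets of points; coefficients that belong
  to the same point are therefore added up.
\<close>

lemma nonneg_definite_kernel_pullback:
  assumes K: "nonneg_definite_kernel \<Omega> (scalar_kernel K)"
    and J: "finite J" "p ` J \<subseteq> \<Omega>"
  shows "nonneg_definite_matrix J (\<lambda>k l. K (p k) (p l))"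
  unfolding nonneg_definite_matrix_def
proof
  fix v :: "'b \<Rightarrow> complex"
  define X where "X = p ` J"
  define u where "u y = (\<Sum>k | k \<in> J \<and> p k = fst y. v k)" for y :: "'a \<times> 1"
  have group: "(\<Sum>x\<in>X. \<Sum>k | k \<in> J \<and> p k = x. h k) = (\<Sum>k\<in>J. h k)" for h :: "'b \<Rightarrow> complex"
    unfolding X_def using J(1) by (simp add: sum.image_gen[symmetric])
  have "X \<times> UNIV = (\<lambda>x. (x, 1::1)) ` X" by (auto simp: num1_eq1)
  then have "quad_form (X \<times> UNIV) (block_matrix (scalar_kernel K)) u
     = (\<Sum>x\<in>X. \<Sum>y\<in>X. cnj (u (x,1)) * K x y * u (y,1))"
    unfolding quad_form_def
    by (simp add: sum.reindex inj_on_def block_matrix_def scalar_kernel_def mat_def)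
  also have "\<dots> = (\<Sum>x\<in>X. \<Sum>k | k \<in> J \<and> p k = x. \<Sum>y\<in>X. \<Sum>l | l \<in> J \<and> p l = y. cnj (v k) * K (p k) (p l) * v l)"
  proof (rule sum.cong[OF refl])
    fix x assume "x \<in> X"
    have "(\<Sum>y\<in>X. cnj (u (x,1)) * K x y * u (y,1))
       = (\<Sum>y\<in>X. \<Sum>k | k \<in> J \<and> p k = x. \<Sum>l | l \<in> J \<and> p l = y. cnj (v k) * K (p k) (p l) * v l)"
    proof (rule sum.cong[OF refl])
      fix y assume "y \<in> X"
      have "cnj (u (x,1)) * K x y * u (y,1)
          = (\<Sum>k | k \<in> J \<and> p k = x. cnj (v k) * K x y) * (\<Sum>l | l \<in> J \<and> p l = y. v l)"
        by (simp add: u_def sum_distrib_right)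
      also have "\<dots> = (\<Sum>k | k \<in> J \<and> p k = x. \<Sum>l | l \<in> J \<and> p l = y. cnj (v k) * K (p k) (p l) * v l)"
        unfolding sum_product by (intro sum.cong refl) auto
      finally show "cnj (u (x,1)) * K x y * u (y,1) = \<dots>" .
    qed
    also have "\<dots> = (\<Sum>k | k \<in> J \<and> p k = x. \<Sum>y\<in>X. \<Sum>l | l \<in> J \<and> p l = y. cnj (v k) * K (p k) (p l) * v l)"
      by (rule sum.swap)
    finally show "(\<Sum>y\<in>X. cnj (u (x,1)) * K x y * u (y,1)) = \<dots>" .
  qed
  also have "\<dots> = quad_form J (\<lambda>k l. K (p k) (p l)) v"
    unfolding group quad_form_def ..
  finally show "quad_form J (\<lambda>k l. K (p k) (p l)) v \<in> \<real> \<and> 0 \<le> Re (quad_form J (\<lambda>k l. K (p k) (p l)) v)"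
    using K J unfolding nonneg_definite_kernel_def nonneg_definite_matrix_def X_def
    by (metis finite_imageI)
qed

lemma nonneg_definite_scalar_kernel_add:
  assumes "nonneg_definite_kernel \<Omega> (scalar_kernel A)" "nonneg_definite_kernel \<Omega> (scalar_kernel B)"
  shows "nonneg_definite_kernel \<Omega> (scalar_kernel (\<lambda>z w. A z w + B z w))"
proof -
  have "block_matrix (scalar_kernel (\<lambda>z w. A z w + B z w))
      = (\<lambda>p q. block_matrix (scalar_kernel A) p q + block_matrix (scalar_kernel B) p q)"
    by (simp add: fun_eq_iff block_matrix_def scalar_kernel_def mat_def)
  then show ?thesis
    using assms by (simp add: nonneg_definite_kernel_def nonneg_definite_matrix_add)
qed

text \<open>
  With \<open>A(z,w) = \<langle>e(z), e(w)\<rangle>\<close> and \<open>B(z,w) = \<langle>f(z), f(w)\<rangle>\<close> this is the Gram matrix of the vectors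
  \<open>e(x\<^sub>p) \<otimes> f(x'\<^sub>p) - e(x'\<^sub>p) \<otimes> f(x\<^sub>p)\<close>. Each of them is a combination of two elementary tensors, so the
  form arises from the Schur product over \<open>P \<times> bool\<close>, where the boolean selects the tensor and
  its sign.
\<close>

lemma nonneg_definite_antisymmetrized_product:
  assumes P: "finite P" "x ` P \<subseteq> \<Omega>" "x' ` P \<subseteq> \<Omega>"
    and A: "nonneg_definite_kernel \<Omega> (scalar_kernel A)"
    and B: "nonneg_definite_kernel \<Omega> (scalar_kernel B)"
  shows "nonneg_definite_matrix (P :: 'i set) (\<lambda>p q.
     A (x p) (x q) * B (x' p) (x' q) - A (x p) (x' q) * B (x' p) (x q)
     - A (x' p) (x q) * B (x p) (x' q) + A (x' p) (x' q) * B (x p) (x q))"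
    (is "nonneg_definite_matrix P ?N")
  unfolding nonneg_definite_matrix_def
proof
  fix v :: "'i \<Rightarrow> complex"
  define J where "J = P \<times> (UNIV :: bool set)"
  define a where "a k = (if snd k then x (fst k) else x' (fst k))" for k
  define b where "b k = (if snd k then x' (fst k) else x (fst k))" for k
  define w where "w k = (if snd k then v (fst k) else - v (fst k))" for k
  have J: "finite J" "a ` J \<subseteq> \<Omega>" "b ` J \<subseteq> \<Omega>"
    using P by (auto simp: J_def a_def b_def)
  have "nonneg_definite_matrix J (\<lambda>k l. A (a k) (a l) * B (b k) (b l))"
    by (rule nonneg_definite_schur_product[OF J(1) nonneg_definite_kernel_pullback[OF A J(1,2)]
          nonneg_definite_kernel_pullback[OF B J(1,3)]])
  moreover have "quad_form J (\<lambda>k l. A (a k) (a l) * B (b k) (b l)) w = quad_form P ?N v"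
  proof -
    have sumJ: "(\<Sum>k\<in>J. h k) = (\<Sum>p\<in>P. h (p, True) + h (p, False))" for h :: "_ \<Rightarrow> complex"
      unfolding J_def by (simp add: sum.cartesian_product' UNIV_bool add.commute)
    show ?thesis
      unfolding quad_form_def sumJ
      by (simp add: a_def b_def w_def sum.distrib[symmetric] algebra_simps)
  qed
  ultimately show "quad_form P ?N v \<in> \<real> \<and> 0 \<le> Re (quad_form P ?N v)"
    unfolding nonneg_definite_matrix_def by metis
qed

lemma nonneg_definite_matrix_limit:
  assumes F: "F \<noteq> bot" and lim: "\<And>p q. p \<in> P \<Longrightarrow> q \<in> P \<Longrightarrow> ((\<lambda>h. of_real (c h) * N h p q) \<longlongrightarrow> L p q) F"
    and nonneg: "\<forall>\<^sub>F h in F. 0 \<le> c h \<and> nonneg_definite_matrix P (N h)"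
  shows "nonneg_definite_matrix P L"
  unfolding nonneg_definite_matrix_def
proof
  fix v
  have "((\<lambda>h. \<Sum>p\<in>P. \<Sum>q\<in>P. cnj (v p) * (of_real (c h) * N h p q) * v q) \<longlongrightarrow> quad_form P L v) F"
    unfolding quad_form_def by (intro tendsto_intros lim)
  moreover have "(\<Sum>p\<in>P. \<Sum>q\<in>P. cnj (v p) * (of_real (c h) * N h p q) * v q)
      = of_real (c h) * quad_form P (N h) v" for h
    by (simp add: quad_form_def sum_distrib_left mult_ac)
  ultimately have lim: "((\<lambda>h. of_real (c h) * quad_form P (N h) v) \<longlongrightarrow> quad_form P L v) F" by simp
  have ev: "\<forall>\<^sub>F h in F. of_real (c h) * quad_form P (N h) v \<in> {z. z \<in> \<real> \<and> 0 \<le> Re z}"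
    using nonneg by eventually_elim (auto simp: nonneg_definite_matrix_def)
  have "closed {z. z \<in> \<real> \<and> 0 \<le> Re z}"
    by (intro closed_Collect_conj closed_Collect_le continuous_intros) (simp add: closed_complex_Reals)
  from Lim_in_closed_set[OF this ev F lim]
  show "quad_form P L v \<in> \<real> \<and> 0 \<le> Re (quad_form P L v)" by simp
qed

section \<open>Wirtinger derivatives as limits of difference quotients\<close>

lemma norm_axis_complex: "norm (axis i (c :: complex) :: complex ^ 'm) = cmod c"
  by (simp add: norm_vec_def L2_set_def axis_def if_distrib[of norm] if_distrib[of "\<lambda>x. x^2"] cong: if_cong)

lemma axis_scale_complex: "axis i c = (c *s axis i 1 :: complex ^ 'm)"
  by (simp add: vec_eq_iff axis_def)

lemma axis_add_complex: "axis i (a + b) = (axis i a + axis i b :: complex ^ 'm)"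
  by (simp add: vec_eq_iff axis_def)

lemma holomorphic_slice:
  fixes f :: "complex ^ 'm \<Rightarrow> complex"
  assumes f: "holomorphic_mv_on f \<Omega>" and \<Omega>: "open \<Omega>"
    and S: "open S" "\<And>s. s \<in> S \<Longrightarrow> z + axis i s \<in> \<Omega>"
  shows "(\<lambda>s. f (z + axis i s)) holomorphic_on S"
  unfolding holomorphic_on_open[OF S(1)]
proof
  fix s assume s: "s \<in> S"
  then obtain D where D: "(f has_derivative D) (at (z + axis i s) within \<Omega>)" "\<And>c v. D (c *s v) = c * D v"
    using f S(2) unfolding holomorphic_mv_on_def by blast
  have D': "(f has_derivative D) (at (z + axis i s))"
    using D(1) at_within_open[OF S(2)[OF s] \<Omega>] by simp
  have "bounded_linear (axis i :: complex \<Rightarrow> complex ^ 'm)"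
  proof (rule bounded_linear_intro)
    show "axis i (r *\<^sub>R a) = r *\<^sub>R (axis i a :: complex ^ 'm)" for r a
      by (simp add: vec_eq_iff axis_def)
    show "norm (axis i a :: complex ^ 'm) \<le> norm a * 1" for a
      by (simp add: norm_axis_complex)
  qed (rule axis_add_complex)
  then have "((\<lambda>s. z + axis i s) has_derivative axis i) (at s)"
    by (auto intro!: derivative_eq_intros bounded_linear_imp_has_derivative)
  from diff_chain_at[OF this D'] have "((\<lambda>s. f (z + axis i s)) has_derivative (\<lambda>h. D (axis i h))) (at s)"
    by (simp add: o_def)
  moreover have "(\<lambda>h. D (axis i h)) = (*) (D (axis i 1))"
  proof
    fix h show "D (axis i h) = D (axis i 1) * h"
      using D(2)[of h "axis i 1"] by (simp add: axis_scale_complex[of i h] mult.commute)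
  qed
  ultimately show "\<exists>f'. ((\<lambda>s. f (z + axis i s)) has_field_derivative f') (at s)"
    unfolding has_field_derivative_def by auto
qed

lemma vector_derivative_along_line:
  assumes "(F has_field_derivative D) (at 0)"
  shows "vector_derivative (\<lambda>t::real. F (c * of_real t)) (at 0) = c * D"
proof -
  have "((\<lambda>t::real. c * of_real t) has_vector_derivative c) (at 0)"
    by (auto intro!: derivative_eq_intros)
  then have "((F \<circ> (\<lambda>t::real. c * of_real t)) has_vector_derivative (c * D)) (at 0)"
    using assms by (intro field_vector_diff_chain_at) auto
  then show ?thesis by (simp add: o_def vector_derivative_at)
qed

text \<open>
  On functions holomorphic along the coordinate line the Wirtinger derivative is the complex
  derivative, since the derivative in direction \<open>\<i>\<close> is \<open>\<i>\<close> times the one in direction \<open>1\<close>.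
\<close>

lemma wirtinger_eq:
  assumes "((\<lambda>s. f (z + axis i s)) has_field_derivative D) (at 0)"
  shows "wirtinger i f z = D"
  using vector_derivative_along_line[OF assms, of 1] vector_derivative_along_line[OF assms, of \<i>]
  by (simp add: wirtinger_def)

lemma wirtinger_bar_eq:
  assumes "((\<lambda>t. f (z + axis j (cnj t))) has_field_derivative D) (at 0)"
  shows "wirtinger_bar j f z = D"
  using vector_derivative_along_line[OF assms, of 1] vector_derivative_along_line[OF assms, of "-\<i>"]
  by (simp add: wirtinger_bar_def)

text \<open>
  Conjugating the second increment makes \<open>\<phi>\<close> separately holomorphic, so the results on two complex
  variables apply. At real \<open>h\<close>, where the limits are used, the conjugation has no effect.
\<close>

lemma wirtinger_difference_quotients:
  fixes K :: "complex ^ 'm \<Rightarrow> complex ^ 'm \<Rightarrow> complex" and i j :: 'm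
  assumes \<Omega>: "open \<Omega>" and K: "sesqui_analytic_on \<Omega> (scalar_kernel K)" and zw: "z \<in> \<Omega>" "w \<in> \<Omega>"
  defines "\<phi> \<equiv> \<lambda>s t. K (z + axis i s) (w + axis j (cnj t))"
  shows "((\<lambda>h. (\<phi> h 0 - \<phi> 0 0) / h) \<longlongrightarrow> wirtinger i (\<lambda>z'. K z' w) z) (at 0)"
    and "((\<lambda>h. (\<phi> 0 h - \<phi> 0 0) / h) \<longlongrightarrow> wirtinger_bar j (\<lambda>w'. K z w') w) (at 0)"
    and "((\<lambda>h. (\<phi> h h - \<phi> h 0 - \<phi> 0 h + \<phi> 0 0) / h^2) \<longlongrightarrow>
           wirtinger i (\<lambda>z'. wirtinger_bar j (\<lambda>w'. K z' w') w) z) (at 0)"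
proof -
  have hol1: "holomorphic_mv_on (\<lambda>z. K z w) \<Omega>" if "w \<in> \<Omega>" for w
    using K that unfolding sesqui_analytic_on_def scalar_kernel_def by (simp add: mat_def num1_eq1)
  have hol2: "holomorphic_mv_on (\<lambda>w. cnj (K z w)) \<Omega>" if "z \<in> \<Omega>" for z
    using K that unfolding sesqui_analytic_on_def scalar_kernel_def antiholomorphic_mv_on_def
    by (simp add: mat_def num1_eq1)
  obtain r1 where r1: "r1 > 0" "ball z r1 \<subseteq> \<Omega>" using \<Omega> zw(1) open_contains_ball by blast
  obtain r2 where r2: "r2 > 0" "ball w r2 \<subseteq> \<Omega>" using \<Omega> zw(2) open_contains_ball by blast
  define R where "R = min r1 r2"
  have R: "R > 0" using r1 r2 by (simp add: R_def)
  have zs: "z + axis i s \<in> \<Omega>" if "s \<in> ball 0 R" for s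
  proof -
    have "z + axis i s \<in> ball z r1" using that by (simp add: dist_norm norm_axis_complex R_def)
    then show ?thesis using r1 by blast
  qed
  have wt: "w + axis j t \<in> \<Omega>" if "t \<in> ball 0 R" for t
  proof -
    have "w + axis j t \<in> ball w r2" using that by (simp add: dist_norm norm_axis_complex R_def)
    then show ?thesis using r2 by blast
  qed
  have sep: "separately_holomorphic (ball 0 R) (ball 0 R) \<phi>"
    unfolding separately_holomorphic_def
  proof (intro conjI ballI)
    fix t :: complex assume t: "t \<in> ball 0 R"
    then have "w + axis j (cnj t) \<in> \<Omega>" by (intro wt) simp
    then show "(\<lambda>s. \<phi> s t) holomorphic_on ball 0 R"
      unfolding \<phi>_def by (rule holomorphic_slice[OF hol1 \<Omega> open_ball zs])
  next
    fix s :: complex assume s: "s \<in> ball 0 R"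
    have "(\<lambda>t. cnj (K (z + axis i s) (w + axis j t))) holomorphic_on ball 0 R"
      by (rule holomorphic_slice[OF hol2[OF zs[OF s]] \<Omega> open_ball wt])
    moreover have "cnj ` ball 0 R = ball 0 R"
    proof -
      have "t \<in> cnj ` ball 0 R" if "t \<in> ball 0 R" for t
        using that by (intro image_eqI[of _ _ "cnj t"]) auto
      then show ?thesis by auto
    qed
    ultimately have "cnj \<circ> (\<lambda>t. cnj (K (z + axis i s) (w + axis j t))) \<circ> cnj holomorphic_on ball 0 R"
      by (intro holomorphic_on_compose_cnj_cnj) auto
    then show "\<phi> s holomorphic_on ball 0 R"
      by (simp add: \<phi>_def o_def)
  qed
  have R0: "0 \<in> ball (0::complex) R" using R by simp
  have d1: "((\<lambda>s. \<phi> s 0) has_field_derivative deriv (\<lambda>s. \<phi> s 0) 0) (at 0)"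
    using sep R0 by (auto simp: separately_holomorphic_def intro!: holomorphic_derivI)
  have d2: "(\<phi> s has_field_derivative deriv (\<phi> s) 0) (at 0)" if "s \<in> ball 0 R" for s
    using sep R0 that by (auto simp: separately_holomorphic_def intro!: holomorphic_derivI)
  have axis0: "axis k (0::complex) = (0 :: complex ^ 'm)" for k by (simp add: vec_eq_iff axis_def)
  have w1: "wirtinger i (\<lambda>z'. K z' w) z = deriv (\<lambda>s. \<phi> s 0) 0"
    by (rule wirtinger_eq) (use d1 in \<open>simp add: \<phi>_def axis0\<close>)
  have wbar: "wirtinger_bar j (\<lambda>w'. K (z + axis i s) w') w = deriv (\<phi> s) 0" if "s \<in> ball 0 R" for s
    by (rule wirtinger_bar_eq) (use d2[OF that] in \<open>simp add: \<phi>_def\<close>)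
  have w2: "wirtinger_bar j (\<lambda>w'. K z w') w = deriv (\<phi> 0) 0"
    using wbar[OF R0] by (simp add: axis0)
  obtain \<delta> where \<delta>: "\<delta> > 0" "(\<lambda>s. deriv (\<phi> s) 0) holomorphic_on ball 0 \<delta>"
    using mixed_difference_quotient_tendsto(1)[OF sep R] by blast
  have w12: "wirtinger i (\<lambda>z'. wirtinger_bar j (\<lambda>w'. K z' w') w) z = deriv (\<lambda>s. deriv (\<phi> s) 0) 0"
  proof (rule wirtinger_eq)
    have "((\<lambda>s. deriv (\<phi> s) 0) has_field_derivative deriv (\<lambda>s. deriv (\<phi> s) 0) 0) (at 0)"
      using \<delta> by (auto intro!: holomorphic_derivI)
    then show "((\<lambda>s. wirtinger_bar j (\<lambda>w'. K (z + axis i s) w') w) has_field_derivative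
        deriv (\<lambda>s. deriv (\<phi> s) 0) 0) (at 0)"
      by (rule has_field_derivative_transform_within_open[OF _ open_ball R0]) (simp add: wbar)
  qed
  show "((\<lambda>h. (\<phi> h 0 - \<phi> 0 0) / h) \<longlongrightarrow> wirtinger i (\<lambda>z'. K z' w) z) (at 0)"
    using DERIV_D[OF d1] by (simp add: w1)
  show "((\<lambda>h. (\<phi> 0 h - \<phi> 0 0) / h) \<longlongrightarrow> wirtinger_bar j (\<lambda>w'. K z w') w) (at 0)"
    using DERIV_D[OF d2[OF R0]] by (simp add: w2)
  show "((\<lambda>h. (\<phi> h h - \<phi> h 0 - \<phi> 0 h + \<phi> 0 0) / h^2) \<longlongrightarrow>
           wirtinger i (\<lambda>z'. wirtinger_bar j (\<lambda>w'. K z' w') w) z) (at 0)"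
    using mixed_difference_quotient_tendsto(2)[OF sep R] by (simp add: w12)
qed

section \<open>Comparison of the curvatures\<close>

text \<open>
  The antisymmetrised product can be rewritten as
  \<open>A (\<Delta>\<Delta>B) + B (\<Delta>\<Delta>A) - (\<Delta>A)(\<Delta>\<^sup>*B) - (\<Delta>B)(\<Delta>\<^sup>*A)\<close> with \<open>\<Delta>\<close> and \<open>\<Delta>\<^sup>*\<close> the first differences in the two
  arguments and \<open>\<Delta>\<Delta>\<close> the mixed second difference. Divided by \<open>2h\<^sup>2\<close> it tends to half the polarised
  curvature form at \<open>A = K1 + K2\<close> and \<open>B = K1 - K2\<close>, which is the difference of the curvatures.
\<close>

lemma gaussian_curvature_difference_limit:
  fixes K1 K2 :: "complex ^ 'm \<Rightarrow> complex ^ 'm \<Rightarrow> complex" and i j :: 'm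
  assumes \<Omega>: "open \<Omega>"
    and K: "sesqui_analytic_on \<Omega> (scalar_kernel K1)" "sesqui_analytic_on \<Omega> (scalar_kernel K2)"
    and xy: "x \<in> \<Omega>" "y \<in> \<Omega>"
  defines "A \<equiv> \<lambda>z w. K1 z w + K2 z w" and "B \<equiv> \<lambda>z w. K1 z w - K2 z w"
  shows "((\<lambda>h::real. of_real (1 / (2 * h^2)) *
      (A x y * B (x + axis i (of_real h)) (y + axis j (of_real h))
       - A x (y + axis j (of_real h)) * B (x + axis i (of_real h)) y
       - A (x + axis i (of_real h)) y * B x (y + axis j (of_real h))
       + A (x + axis i (of_real h)) (y + axis j (of_real h)) * B x y))
    \<longlongrightarrow> (gaussian_curvature K1 x y - gaussian_curvature K2 x y) $ i $ j) (at_right 0)"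
proof -
  define \<phi>1 where "\<phi>1 s t = K1 (x + axis i s) (y + axis j (cnj t))" for s t
  define \<phi>2 where "\<phi>2 s t = K2 (x + axis i s) (y + axis j (cnj t))" for s t
  define \<alpha> where "\<alpha> s t = \<phi>1 s t + \<phi>2 s t" for s t
  define \<beta> where "\<beta> s t = \<phi>1 s t - \<phi>2 s t" for s t
  define b1 where "b1 = wirtinger i (\<lambda>z'. K1 z' y) x"
  define b2 where "b2 = wirtinger i (\<lambda>z'. K2 z' y) x"
  define c1 where "c1 = wirtinger_bar j (\<lambda>w'. K1 x w') y"
  define c2 where "c2 = wirtinger_bar j (\<lambda>w'. K2 x w') y"
  define d1 where "d1 = wirtinger i (\<lambda>z'. wirtinger_bar j (\<lambda>w'. K1 z' w') y) x"
  define d2 where "d2 = wirtinger i (\<lambda>z'. wirtinger_bar j (\<lambda>w'. K2 z' w') y) x"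
  note q1 = wirtinger_difference_quotients[OF \<Omega> K(1) xy, of i j, folded \<phi>1_def b1_def c1_def d1_def]
  note q2 = wirtinger_difference_quotients[OF \<Omega> K(2) xy, of i j, folded \<phi>2_def b2_def c2_def d2_def]
  (* the first differences in each argument and the mixed second difference, as operators on kernels *)
  define S where "S \<psi> h = (\<psi> h 0 - \<psi> 0 0) / h" for \<psi> :: "complex \<Rightarrow> complex \<Rightarrow> complex" and h
  define T where "T \<psi> h = (\<psi> 0 h - \<psi> 0 0) / h" for \<psi> :: "complex \<Rightarrow> complex \<Rightarrow> complex" and h
  define M where "M \<psi> h = (\<psi> h h - \<psi> h 0 - \<psi> 0 h + \<psi> 0 0) / h^2"
    for \<psi> :: "complex \<Rightarrow> complex \<Rightarrow> complex" and h
  note lims = q1[folded S_def T_def M_def] q2[folded S_def T_def M_def]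
  have comb: "S \<alpha> h = S \<phi>1 h + S \<phi>2 h" "S \<beta> h = S \<phi>1 h - S \<phi>2 h"
    "T \<alpha> h = T \<phi>1 h + T \<phi>2 h" "T \<beta> h = T \<phi>1 h - T \<phi>2 h"
    "M \<alpha> h = M \<phi>1 h + M \<phi>2 h" "M \<beta> h = M \<phi>1 h - M \<phi>2 h" for h
    by (simp_all add: S_def T_def M_def \<alpha>_def \<beta>_def add_divide_distrib[symmetric] diff_divide_distrib[symmetric] algebra_simps)
  define L where "L h = (\<alpha> 0 0 * M \<beta> h + \<beta> 0 0 * M \<alpha> h - S \<alpha> h * T \<beta> h - S \<beta> h * T \<alpha> h) / 2" for h
  define lim where "lim = (\<alpha> 0 0 * (d1 - d2) + \<beta> 0 0 * (d1 + d2) - (b1 + b2) * (c1 - c2) - (b1 - b2) * (c1 + c2)) / 2"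
  have "(L \<longlongrightarrow> lim) (at 0)"
    unfolding L_def lim_def comb by (intro tendsto_intros lims) auto
  moreover have "filterlim (\<lambda>h::real. of_real h :: complex) (at 0) (at_right 0)"
    unfolding filterlim_at
    by (auto intro!: tendsto_eq_intros simp: eventually_at_filter)
  ultimately have Lh: "((\<lambda>h::real. L (of_real h)) \<longlongrightarrow> lim) (at_right 0)"
    by (rule filterlim_compose)
  have axis0: "axis k (0::complex) = (0 :: complex ^ 'm)" for k by (simp add: vec_eq_iff axis_def)
  have "\<phi>1 0 0 = K1 x y" "\<phi>2 0 0 = K2 x y" by (simp_all add: \<phi>1_def \<phi>2_def axis0)
  then have "lim = (gaussian_curvature K1 x y - gaussian_curvature K2 x y) $ i $ j"
    unfolding lim_def gaussian_curvature_def
    by (simp add: b1_def[symmetric] b2_def[symmetric] c1_def[symmetric] c2_def[symmetric]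
        d1_def[symmetric] d2_def[symmetric] \<alpha>_def \<beta>_def field_simps)
  with Lh have Lh': "((\<lambda>h::real. L (of_real h)) \<longlongrightarrow> (gaussian_curvature K1 x y - gaussian_curvature K2 x y) $ i $ j) (at_right 0)"
    by simp
  have eq: "L h = (\<alpha> 0 0 * \<beta> h h - \<alpha> 0 h * \<beta> h 0 - \<alpha> h 0 * \<beta> 0 h + \<alpha> h h * \<beta> 0 0) / (2 * h^2)"
    if "h \<noteq> 0" for h
    using that by (simp add: L_def S_def T_def M_def power2_eq_square field_simps)
  have A\<alpha>: "A (x + axis i s) (y + axis j (cnj t)) = \<alpha> s t" "B (x + axis i s) (y + axis j (cnj t)) = \<beta> s t" for s t
    by (simp_all add: A_def B_def \<alpha>_def \<beta>_def \<phi>1_def \<phi>2_def)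
  show ?thesis
  proof (rule Lim_transform_eventually[OF Lh'])
    have "\<forall>\<^sub>F h in at_right (0::real). 0 < h"
      by (simp add: eventually_at_filter)
    then show "\<forall>\<^sub>F h in at_right 0. L (of_real h) = of_real (1 / (2 * h^2)) *
      (A x y * B (x + axis i (of_real h)) (y + axis j (of_real h))
       - A x (y + axis j (of_real h)) * B (x + axis i (of_real h)) y
       - A (x + axis i (of_real h)) y * B x (y + axis j (of_real h))
       + A (x + axis i (of_real h)) (y + axis j (of_real h)) * B x y)"
    proof eventually_elim
      case (elim h)
      have "A x y = \<alpha> 0 0" "B x y = \<beta> 0 0"
        "A x (y + axis j (of_real h)) = \<alpha> 0 (of_real h)" "B x (y + axis j (of_real h)) = \<beta> 0 (of_real h)"
        "A (x + axis i (of_real h)) y = \<alpha> (of_real h) 0" "B (x + axis i (of_real h)) y = \<beta> (of_real h) 0"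
        "A (x + axis i (of_real h)) (y + axis j (of_real h)) = \<alpha> (of_real h) (of_real h)"
        "B (x + axis i (of_real h)) (y + axis j (of_real h)) = \<beta> (of_real h) (of_real h)"
        by (simp_all add: A\<alpha>[symmetric] axis0)
      then show ?case using eq[of "of_real h"] elim by simp
    qed
  qed
qed

theorem proposition2p4:
  fixes \<Omega> :: "(complex ^ 'm) set"
    and K1 K2 :: "complex ^ 'm \<Rightarrow> complex ^ 'm \<Rightarrow> complex"
  assumes "open \<Omega>" and "connected \<Omega>" and "\<Omega> \<noteq> {}"
    and "sesqui_analytic_on \<Omega> (scalar_kernel K1)"
    and "sesqui_analytic_on \<Omega> (scalar_kernel K2)"
    and "pos_definite_kernel \<Omega> (scalar_kernel K1)"
    and "pos_definite_kernel \<Omega> (scalar_kernel K2)"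
    and "kernel_ge \<Omega> (scalar_kernel K1) (scalar_kernel K2)"
  shows "kernel_ge \<Omega> (gaussian_curvature K1) (gaussian_curvature K2)"
  unfolding kernel_ge_def nonneg_definite_kernel_def
proof (intro allI impI)
  fix X assume X: "finite X \<and> X \<subseteq> \<Omega>"
  define A where "A z w = K1 z w + K2 z w" for z w
  define B where "B z w = K1 z w - K2 z w" for z w
  define P where "P = X \<times> (UNIV :: 'm set)"
  have "finite P" using X by (simp add: P_def)
  have A: "nonneg_definite_kernel \<Omega> (scalar_kernel A)"
    unfolding A_def using assms(6,7)
    by (intro nonneg_definite_scalar_kernel_add pos_definite_imp_nonneg_definite_kernel)
  have "(\<lambda>z w. scalar_kernel K1 z w - scalar_kernel K2 z w) = scalar_kernel B"
    by (simp add: fun_eq_iff scalar_kernel_def B_def mat_def vec_eq_iff)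
  then have B: "nonneg_definite_kernel \<Omega> (scalar_kernel B)"
    using assms(8) by (simp add: kernel_ge_def)
  define shift :: "real \<Rightarrow> (complex ^ 'm) \<times> 'm \<Rightarrow> complex ^ 'm"
    where "shift h p = fst p + axis (snd p) (of_real h)" for h p
  define N where "N h p q = A (fst p) (fst q) * B (shift h p) (shift h q)
      - A (fst p) (shift h q) * B (shift h p) (fst q)
      - A (shift h p) (fst q) * B (fst p) (shift h q)
      + A (shift h p) (shift h q) * B (fst p) (fst q)" for h p q
  have "nonneg_definite_matrix P (block_matrix (\<lambda>z w. gaussian_curvature K1 z w - gaussian_curvature K2 z w))"
  proof (rule nonneg_definite_matrix_limit[where F = "at_right (0::real)" and N = N and c = "\<lambda>h. 1 / (2 * h^2)"])
    fix p q assume "p \<in> P" "q \<in> P"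
    then have "fst p \<in> \<Omega>" "fst q \<in> \<Omega>" using X by (auto simp: P_def)
    from gaussian_curvature_difference_limit[OF assms(1,4,5) this, of "snd p" "snd q"]
    show "((\<lambda>h. of_real (1 / (2 * h^2)) * N h p q) \<longlongrightarrow>
        block_matrix (\<lambda>z w. gaussian_curvature K1 z w - gaussian_curvature K2 z w) p q) (at_right 0)"
      unfolding N_def A_def B_def shift_def block_matrix_def .
  next
    have shift_in: "\<forall>\<^sub>F h in at_right 0. shift h p \<in> \<Omega>" if "p \<in> P" for p
    proof -
      have "fst p \<in> \<Omega>" using that X by (auto simp: P_def)
      then obtain r where r: "r > 0" "ball (fst p) r \<subseteq> \<Omega>" using assms(1) open_contains_ball by blast
      have "\<forall>\<^sub>F h in at_right (0::real). h \<in> {0<..<r}"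
        using r(1) by (rule eventually_at_right_real)
      then show ?thesis
      proof eventually_elim
        case (elim h)
        then have "shift h p \<in> ball (fst p) r"
          by (simp add: shift_def dist_norm norm_axis_complex)
        then show ?case using r(2) by blast
      qed
    qed
    then have "\<forall>\<^sub>F h in at_right 0. \<forall>p\<in>P. shift h p \<in> \<Omega>"
      using \<open>finite P\<close> by (simp add: eventually_ball_finite)
    then show "\<forall>\<^sub>F h in at_right 0. 0 \<le> 1 / (2 * h^2) \<and> nonneg_definite_matrix P (N h)"
    proof eventually_elim
      case (elim h)
      have "nonneg_definite_matrix P (N h)"
        unfolding N_def
        by (rule nonneg_definite_antisymmetrized_product[OF \<open>finite P\<close> _ _ A B])
           (use elim X in \<open>auto simp: P_def\<close>)
      then show ?case by simp
    qed
  qed simp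
  then show "nonneg_definite_matrix (X \<times> UNIV)
      (block_matrix (\<lambda>z w. gaussian_curvature K1 z w - gaussian_curvature K2 z w))"
    by (simp add: P_def)
qed

end
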